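(* There exists $d_0$ such that for every $d\ge d_0$ and every convex body $K\subset\mathbb{R}^d$ with $o\in\mathrm{int}(K)$, \[\kappa'(K,o)\ge h'(K)\ge\frac{1}{4d^2}\left(\frac{2}{\sqrt3}\right)^d.\]
   Context: A convex body in $\mathbb{R}^d$ is a compact convex set with non-empty interior. For a convex body $K$ with $o\in\mathrm{int}(K)$, the (possibly asymmetric) norm is $\|x\|_K=\inf\{\lambda>0: x\in\lambda K\}$. $h'(K)$ is the maximum number of points $p_1,\dots,p_m$ on the boundary $\mathrm{bd}\,K$ such that $\|p_i-p_j\|_K>1$ for all distinct $i,j$. A strict Minkowski arrangement of $K$ with respect to $o$ is a family $\{v_i+\lambda_iK\}$ of positive homothets ($\lambda_i>0$, $v_i\in\mathbb{R}^d$) with $v_i\notin v_j+\lambda_jK$ for all distinct $i,j$; $\kappa'(K,o)$ is the largest size of a pairwise intersecting strict Minkowski arrangement of $K$ with respect to $o$. *)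

theory Defs
  imports "HOL-Analysis.Analysis" "HOL-Library.Extended_Real"
begin

text \<open>R^d is modelled as the subspace of nat => real of vectors vanishing at all
  coordinates i >= d (coordinates 0..d-1).  The product topology on nat => real
  restricted to this subspace is the Euclidean topology of R^d.\<close>

definition Rd :: "nat \<Rightarrow> (nat \<Rightarrow> real) set" where
  "Rd d = {x. \<forall>i\<ge>d. x i = 0}"

definition vadd :: "(nat \<Rightarrow> real) \<Rightarrow> (nat \<Rightarrow> real) \<Rightarrow> (nat \<Rightarrow> real)" where
  "vadd x y = (\<lambda>i. x i + y i)"

definition vsub :: "(nat \<Rightarrow> real) \<Rightarrow> (nat \<Rightarrow> real) \<Rightarrow> (nat \<Rightarrow> real)" where
  "vsub x y = (\<lambda>i. x i - y i)"

definition smul :: "real \<Rightarrow> (nat \<Rightarrow> real) \<Rightarrow> (nat \<Rightarrow> real)" where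
  "smul c x = (\<lambda>i. c * x i)"

definition rint :: "nat \<Rightarrow> (nat \<Rightarrow> real) set \<Rightarrow> (nat \<Rightarrow> real) set" where
  "rint d K = (top_of_set (Rd d)) interior_of K"

definition bd :: "nat \<Rightarrow> (nat \<Rightarrow> real) set \<Rightarrow> (nat \<Rightarrow> real) set" where
  "bd d K = (top_of_set (Rd d)) frontier_of K"

definition convex_body :: "nat \<Rightarrow> (nat \<Rightarrow> real) set \<Rightarrow> bool" where
  "convex_body d K \<longleftrightarrow> K \<subseteq> Rd d \<and> compact K \<and>
     (\<forall>x\<in>K. \<forall>y\<in>K. \<forall>u::real. 0 \<le> u \<and> u \<le> 1 \<longrightarrow> vadd (smul (1 - u) x) (smul u y) \<in> K) \<and>
     rint d K \<noteq> {}"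

definition normK :: "(nat \<Rightarrow> real) set \<Rightarrow> (nat \<Rightarrow> real) \<Rightarrow> real" where
  "normK K x = Inf {l. l > 0 \<and> x \<in> (\<lambda>y. smul l y) ` K}"

definition h' :: "nat \<Rightarrow> (nat \<Rightarrow> real) set \<Rightarrow> enat" where
  "h' d K = (SUP P \<in> {P. finite P \<and> P \<subseteq> bd d K \<and>
        (\<forall>p\<in>P. \<forall>q\<in>P. p \<noteq> q \<longrightarrow> normK K (vsub p q) > 1)}. enat (card P))"

definition homothet :: "(nat \<Rightarrow> real) set \<Rightarrow> (nat \<Rightarrow> real) \<times> real \<Rightarrow> (nat \<Rightarrow> real) set" where
  "homothet K a = (\<lambda>y. vadd (fst a) (smul (snd a) y)) ` K"

definition pi_strict_minkowski :: "nat \<Rightarrow> (nat \<Rightarrow> real) set \<Rightarrow> ((nat \<Rightarrow> real) \<times> real) set \<Rightarrow> bool" where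
  "pi_strict_minkowski d K F \<longleftrightarrow>
     (\<forall>a\<in>F. fst a \<in> Rd d \<and> snd a > 0) \<and>
     (\<forall>a\<in>F. \<forall>b\<in>F. a \<noteq> b \<longrightarrow> fst a \<notin> homothet K b) \<and>
     (\<forall>a\<in>F. \<forall>b\<in>F. homothet K a \<inter> homothet K b \<noteq> {})"

definition kappa' :: "nat \<Rightarrow> (nat \<Rightarrow> real) set \<Rightarrow> enat" where
  "kappa' d K = (SUP F \<in> {F. finite F \<and> pi_strict_minkowski d K F}. enat (card F))"

end

theory Submission
  imports Defs "HOL-Probability.Probability"
begin

text \<open>
  If x and y are independent and uniform in K, the probability that x - y lies in K is at most
  (sqrt 3 / 2)^d.  This is the sharp Young (Brascamp-Lieb) inequality for the three linear forms
  x, y, x - y with all exponents 3/2, applied to indicator functions.  On the line it is proved by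
  monotone transport of the three densities to a Gaussian, and it tensorizes by applying it on the
  last coordinate and using the integrals over that coordinate as new functions.

  Let c^d = 1/2.  The shell K - cK carries half of the volume, and the pairs (x, y) of points of
  the shell with x - cy or y - cx in K have small measure, so a greedy choice gives about
  (2 / sqrt 3)^d / 64 points without such pairs.  For x in the shell the radial projection to the
  boundary is p = t x with 1 <= t < 1/c, and p - q in K would force
  x - cy = (c/s)(p - q) + (1/t - c/s) p in K, where q = s y.  So the projected points are pairwise
  at distance more than 1.

  If p ranges over such a set of boundary points, the translates K - p all contain the origin and
  form a strict Minkowski arrangement.
\<close>

section \<open>Monotone transport on the line\<close>

text \<open>The exponent 3/2 is forced by scaling: dilating both variables multiplies the double
  integral by the square of the factor and each single integral by the factor itself, so the
  reciprocals of three equal exponents must add up to 2. The constant sqrt 3 / 2 is the mass of the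
  multiple of a planar Gaussian density that the transports produce.

  Boundary points form a null set, which volume estimates cannot see. The shell stands in for the
  boundary, and x - cy stands in for x - y because its position relative to K can be compared with
  that of the projected difference. The choice c^d = 1/2 balances two losses: the shell keeps the
  proportion 1 - c^d of the volume, and substituting cy for y costs the factor 1 / c^d. A value of c
  independent of d would make the total loss exponential. As it is, all losses together come to the
  factor 64, and 4 d^2 is at least 64 from d = 4 on.\<close>

lemma density_antiderivative:
  fixes f :: "real \<Rightarrow> real"
  assumes cont: "continuous_on UNIV f" and pos: "\<And>x. 0 < f x"
    and int: "(\<integral>\<^sup>+x. ennreal (f x) \<partial>lborel) = 1"
  obtains F where "\<And>x. (F has_real_derivative f x) (at x)"
    "(F \<longlongrightarrow> 0) at_bot" "(F \<longlongrightarrow> 1) at_top"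
proof -
  \<comment> \<open>With \<open>f\<close> as the density of a probability measure, its distribution
    function serves as the antiderivative, and the limits 0 and 1 come with it.\<close>
  define M where "M = density lborel (\<lambda>x. ennreal (f x))"
  have fm [measurable]: "f \<in> borel_measurable borel"
    using cont by (rule borel_measurable_continuous_onI)
  interpret real_distribution M
    unfolding real_distribution_def real_distribution_axioms_def
    by (auto simp: M_def int emeasure_density intro!: prob_spaceI)
  have diff: "cdf M x = cdf M a + integral {a..x} f" if "a \<le> x" for a x
  proof (cases "a = x")
    case False
    then have "a < x" using that by simp
    have "emeasure M {a<..x} = (\<integral>\<^sup>+t. ennreal (f t) * indicator {a<..x} t \<partial>lborel)"
      by (simp add: M_def emeasure_density)
    also have "\<dots> = (\<integral>\<^sup>+t. ennreal (f t) * indicator {a..x} t \<partial>lborel)"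
      by (rule nn_integral_cong_AE, rule AE_mp[OF AE_lborel_singleton[of a]])
         (auto split: split_indicator)
    also have "\<dots> = ennreal (integral {a..x} f)"
      by (intro nn_integral_has_integral_lebesgue' integrable_integral integrable_continuous_real
          continuous_on_subset[OF cont] less_imp_le pos subset_UNIV)
    finally have "measure M {a<..x} = integral {a..x} f"
      by (simp add: measure_def less_imp_le pos
          integral_nonneg integrable_continuous_real continuous_on_subset[OF cont])
    then show ?thesis using cdf_diff_eq[OF \<open>a < x\<close>] by simp
  qed simp
  have "(cdf M has_real_derivative f x) (at x)" for x
  proof -
    \<comment> \<open>The fundamental theorem of calculus yields a derivative within an interval;
      centring the interval at \<open>x\<close> turns it into a two-sided one.\<close>
    have "((\<lambda>t. cdf M (x - 1) + integral {x - 1..t} f) has_real_derivative f x) (at x within {x - 1..x + 1})"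
      using integral_has_real_derivative[of "x - 1" "x + 1" f x] continuous_on_subset[OF cont]
      by (auto intro!: derivative_eq_intros)
    then have "(cdf M has_real_derivative f x) (at x within {x - 1..x + 1})"
      by (rule has_field_derivative_transform_within[where d = 1]) (auto intro!: diff[symmetric])
    then show ?thesis
      by (simp add: at_within_Icc_at)
  qed
  then show ?thesis
    by (rule that[OF _ cdf_lim_at_bot cdf_lim_at_top_prob])
qed

lemma antiderivative_strict_mono_bounds:
  fixes F f :: "real \<Rightarrow> real"
  assumes der: "\<And>x. (F has_real_derivative f x) (at x)" and pos: "\<And>x. 0 < f x"
    and bot: "(F \<longlongrightarrow> a) at_bot" and top: "(F \<longlongrightarrow> b) at_top"
  shows "strict_mono F" "a < F x" "F x < b"
proof -
  show mono: "strict_mono F"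
  proof (rule strict_monoI)
    show "F x < F y" if "x < y" for x y
      by (rule DERIV_pos_imp_increasing[OF that]) (use der pos in blast)
  qed
  have "a \<le> F (x - 1)"
    by (rule tendsto_upperbound[OF bot])
      (simp_all add: eventually_at_bot_linorderI[of "x - 1"] strict_mono_less_eq[OF mono])
  also have "\<dots> < F x" using mono by (simp add: strict_mono_less)
  finally show "a < F x" .
  have "F x < F (x + 1)" using mono by (simp add: strict_mono_less)
  also have "\<dots> \<le> b"
    by (rule tendsto_lowerbound[OF top])
      (simp_all add: eventually_at_top_linorderI[of "x + 1"] strict_mono_less_eq[OF mono])
  finally show "F x < b" .
qed

text \<open>The map \<open>T\<close> matches cumulative masses, \<open>G (T x) = F x\<close>, and
  differentiating this identity gives the Jacobian equation. Since \<open>F\<close> takes values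
  strictly between 0 and 1, the inverse of \<open>G\<close> is only ever evaluated on its
  range.\<close>

lemma monotone_transport:
  fixes f g :: "real \<Rightarrow> real"
  assumes contf: "continuous_on UNIV f" and posf: "\<And>x. 0 < f x"
    and intf: "(\<integral>\<^sup>+x. ennreal (f x) \<partial>lborel) = 1"
    and contg: "continuous_on UNIV g" and posg: "\<And>x. 0 < g x"
    and intg: "(\<integral>\<^sup>+x. ennreal (g x) \<partial>lborel) = 1"
  obtains T T' where "\<And>x. (T has_real_derivative T' x) (at x)" "\<And>x. 0 < T' x"
    "\<And>x. f x = g (T x) * T' x"
proof -
  obtain F where F: "\<And>x. (F has_real_derivative f x) (at x)" "(F \<longlongrightarrow> 0) at_bot" "(F \<longlongrightarrow> 1) at_top"
    using density_antiderivative[OF contf posf intf] by blast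
  obtain G where G: "\<And>x. (G has_real_derivative g x) (at x)" "(G \<longlongrightarrow> 0) at_bot" "(G \<longlongrightarrow> 1) at_top"
    using density_antiderivative[OF contg posg intg] by blast
  note Fb = antiderivative_strict_mono_bounds[OF F(1) posf F(2,3)]
  note Gb = antiderivative_strict_mono_bounds[OF G(1) posg G(2,3)]
  have contG: "continuous_on S G" for S
    using G(1) by (meson DERIV_isCont continuous_at_imp_continuous_on)
  have ex: "\<exists>t. G t = y" if "0 < y" "y < 1" for y
  proof -
    have "eventually (\<lambda>t. G t < y) at_bot" using order_tendstoD(2)[OF G(2)] that by auto
    then obtain a where a: "G a < y" by (auto simp: eventually_at_bot_linorder)
    have "eventually (\<lambda>t. y < G t) at_top" using order_tendstoD(1)[OF G(3)] that by auto
    then obtain b where b: "y < G b" by (auto simp: eventually_at_top_linorder)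
    have "a \<le> b" using a b strict_mono_less[OF Gb(1), of a b] by simp
    then show ?thesis using IVT'[of G a y b] a b contG by force
  qed
  define H where "H = inv G"
  have GH: "G (H y) = y" if "0 < y" "y < 1" for y
    unfolding H_def using ex[OF that] by (metis f_inv_into_f rangeI)
  have HG: "H (G x) = x" for x
    unfolding H_def using strict_mono_imp_inj_on[OF Gb(1)] by simp
  have contH: "isCont H (G x)" for x
    by (rule isCont_inverse_function[where d = 1 and f = G]) (auto simp: HG intro: DERIV_isCont[OF G(1)])
  have derH: "(H has_real_derivative inverse (g (H y))) (at y)" if "0 < y" "y < 1" for y
  proof (rule DERIV_inverse_function[where f = G and a = 0 and b = 1])
    show "g (H y) \<noteq> 0" using posg[of "H y"] by simp
    show "isCont H y" using contH[of "H y"] by (simp add: GH that)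
  qed (simp_all add: G(1) GH that)
  define T where "T = (\<lambda>x. H (F x))"
  define T' where "T' = (\<lambda>x. f x / g (T x))"
  have der: "(T has_real_derivative T' x) (at x)" for x
    unfolding T_def using DERIV_chain2[OF derH[OF Fb(2,3)] F(1), of x]
    by (simp add: T'_def T_def field_simps)
  have "0 < T' x" for x using posf posg by (simp add: T'_def)
  moreover have "f x = g (T x) * T' x" for x using less_imp_neq[OF posg] by (simp add: T'_def)
  ultimately show ?thesis using der that by blast
qed

section \<open>The Brascamp-Lieb inequality on the line\<close>

text \<open>A bridge between two settings: the change of variables with a determinant takes place in
  \<open>real^2\<close>, while the inequality itself speaks of iterated integrals.\<close>

lemma nn_integral_lborel_real2:
  fixes F :: "real^2 \<Rightarrow> ennreal"
  assumes [measurable]: "F \<in> borel_measurable borel"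
  shows "(\<integral>\<^sup>+z. F z \<partial>lborel) = (\<integral>\<^sup>+x. \<integral>\<^sup>+y. F (x *\<^sub>R axis 1 1 + y *\<^sub>R axis 2 1) \<partial>lborel \<partial>lborel)"
proof -
  let ?v = "\<lambda>p::real \<times> real. fst p *\<^sub>R axis 1 1 + snd p *\<^sub>R axis 2 1 :: real^2"
  have [measurable]: "?v \<in> borel_measurable borel"
    by (intro borel_measurable_continuous_onI continuous_intros)
  have lborel2: "lborel = distr (lborel \<Otimes>\<^sub>M lborel) borel ?v"
  proof (rule lborel_eqI)
    fix l u :: "real^2" assume le: "\<And>b. b \<in> Basis \<Longrightarrow> l \<bullet> b \<le> u \<bullet> b"
    have le': "l $ i \<le> u $ i" for i
      using le[of "axis i 1"] by (simp add: inner_axis axis_in_Basis_iff)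
    have B: "Basis = (\<lambda>i. axis i 1 :: real^2) ` UNIV"
      by (auto simp: Basis_vec_def)
    have "?v -` box l u = {l$1<..<u$1} \<times> {l$2<..<u$2}"
      by (auto simp: mem_box_cart forall_2 axis_def)
    moreover have "(\<Prod>b\<in>Basis. (u - l) \<bullet> b) = (u$1 - l$1) * (u$2 - l$2)"
      unfolding B by (subst prod.reindex) (auto simp: UNIV_2 inner_axis inj_on_def axis_eq_axis)
    ultimately show "emeasure (distr (lborel \<Otimes>\<^sub>M lborel) borel ?v) (box l u) = (\<Prod>b\<in>Basis. (u - l) \<bullet> b)"
      using le'[of 1] le'[of 2]
      by (simp add: emeasure_distr lborel.emeasure_pair_measure_Times space_pair_measure ennreal_mult borel_prod)
  qed simp
  have "(\<integral>\<^sup>+z. F z \<partial>lborel) = (\<integral>\<^sup>+p. F (?v p) \<partial>(lborel \<Otimes>\<^sub>M lborel))"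
    by (subst lborel2) (simp add: nn_integral_distr borel_prod)
  also have "\<dots> = (\<integral>\<^sup>+x. \<integral>\<^sup>+y. F (?v (x, y)) \<partial>lborel \<partial>lborel)"
    by (rule lborel.nn_integral_fst[symmetric]) (simp add: borel_prod)
  finally show ?thesis by simp
qed

text \<open>This is an inequality because \<open>\<theta>\<close> may fail to be onto; the mass of
  \<open>\<phi>\<close> off its range is discarded. Injectivity excludes double counting and,
  through invariance of domain, makes the range open and hence measurable.\<close>

lemma nn_integral_change_of_variables_le:
  fixes \<theta> :: "real^'m::{finite,wellorder} \<Rightarrow> real^'m::_" and \<phi> :: "real^'m::_ \<Rightarrow> real"
  assumes der: "\<And>z. (\<theta> has_derivative \<theta>' z) (at z)" and inj: "inj \<theta>"
    and int: "integrable lborel \<phi>" and nonneg: "\<And>w. 0 \<le> \<phi> w"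
  shows "(\<integral>\<^sup>+z. ennreal (\<bar>det (matrix (\<theta>' z))\<bar> * \<phi> (\<theta> z)) \<partial>lborel) \<le> (\<integral>\<^sup>+w. ennreal (\<phi> w) \<partial>lborel)"
proof -
  \<comment> \<open>The change-of-variables theorem applied here concerns vector-valued integrands,
    so the scalar \<open>\<phi>\<close> is wrapped as a vector of length 1.\<close>
  let ?v = "vec :: real \<Rightarrow> real^1"
  let ?D = "\<lambda>z. \<bar>det (matrix (\<theta>' z))\<bar> * \<phi> (\<theta> z)"
  have "continuous_on UNIV \<theta>"
    using der by (meson continuous_at_imp_continuous_on has_derivative_continuous)
  then have "open (range \<theta>)"
    using inj by (intro invariance_of_domain) auto
  then have meas: "range \<theta> \<in> sets lebesgue" by simp
  have ai: "\<phi> absolutely_integrable_on UNIV"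
    using int by (simp add: set_integrable_def integrable_completion)
  then have ai': "\<phi> absolutely_integrable_on range \<theta>"
    by (rule set_integrable_subset) (use meas in auto)
  have "(\<lambda>z. \<bar>det (matrix (\<theta>' z))\<bar> *\<^sub>R ?v (\<phi> (\<theta> z))) absolutely_integrable_on UNIV \<and>
      integral UNIV (\<lambda>z. \<bar>det (matrix (\<theta>' z))\<bar> *\<^sub>R ?v (\<phi> (\<theta> z))) = ?v (integral (range \<theta>) \<phi>)"
    by (subst has_absolute_integral_change_of_variables[where f = "\<lambda>w. ?v (\<phi> w)"])
      (use der inj ai' in \<open>auto simp: absolutely_integrable_on_1_iff integral_on_1_eq o_def\<close>)
  then have D: "?D absolutely_integrable_on UNIV" "integral UNIV ?D = integral (range \<theta>) \<phi>"
    by (auto simp: absolutely_integrable_on_1_iff integral_on_1_eq o_def vec_eq_iff)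
  have "(\<integral>\<^sup>+z. ennreal (?D z) * indicator UNIV z \<partial>lborel) = ennreal (integral UNIV ?D)"
    by (intro nn_integral_has_integral_lebesgue' integrable_integral)
      (use D nonneg in \<open>auto simp: set_lebesgue_integral_eq_integral\<close>)
  also have "\<dots> = ennreal (integral (range \<theta>) \<phi>)" by (simp add: D)
  also have "\<dots> \<le> ennreal (integral UNIV \<phi>)"
    by (intro ennreal_leI integral_subset_le set_lebesgue_integral_eq_integral ai ai') (use nonneg in auto)
  also have "\<dots> = (\<integral>\<^sup>+w. ennreal (\<phi> w) * indicator UNIV w \<partial>lborel)"
    by (intro nn_integral_has_integral_lebesgue'[symmetric] integrable_integral)
      (use ai nonneg in \<open>auto simp: set_lebesgue_integral_eq_integral\<close>)
  finally show ?thesis by simp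
qed

text \<open>AM-GM for three numbers whose product is \<open>(u * v * w)^2\<close>, which explains
  the exponent 2/3. The right-hand side will be the Jacobian determinant of the combined transport.
  With cube roots substituted, the claim is the factorization of p^3 + q^3 + r^3 - 3pqr.\<close>

lemma arith_geo_mean_pairs:
  fixes u v w :: real
  assumes "0 < u" "0 < v" "0 < w"
  shows "3 * (u * v * w) powr (2/3) \<le> u * v + v * w + u * w"
proof -
  define p q r where "p = (u * v) powr (1/3)" and "q = (v * w) powr (1/3)" and "r = (u * w) powr (1/3)"
  have pos: "0 \<le> p" "0 \<le> q" "0 \<le> r" by (auto simp: p_def q_def r_def)
  have cube: "p ^ 3 = u * v" "q ^ 3 = v * w" "r ^ 3 = u * w"
    using assms by (simp_all add: p_def q_def r_def powr_powr flip: powr_numeral)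
  have pqr: "p * q * r = (u * v * w) powr (2/3)"
  proof -
    have "p * q * r = (((u * v * w) powr 2) powr (1/3))"
      using assms by (simp add: p_def q_def r_def power2_eq_square ac_simps flip: powr_mult)
    then show ?thesis by (simp add: powr_powr)
  qed
  have "p^3 + q^3 + r^3 - 3 * (p * q * r) = (p + q + r) * ((p - q)^2 + (q - r)^2 + (p - r)^2) / 2"
    by (simp add: power2_eq_square power3_eq_cube field_simps)
  also have "\<dots> \<ge> 0" using pos by simp
  finally show ?thesis using cube pqr by simp
qed

text \<open>
  The right-hand side is 3 sqrt 3 / 2 times a centred Gaussian probability density in the plane,
  with exponent -(2/9)(p^2 + pq + q^2), evaluated at p = a + c, q = b - c.  The two exponents
  differ by (a - b - c)^2 / 9.
\<close>
lemma std_normal_density_prod_le: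
  fixes a b c :: real
  shows "(std_normal_density a * std_normal_density b * std_normal_density c) powr (2/3)
    \<le> 3 * (sqrt 3 / 2 * (normal_density (- (b - c) / 2) (3/2) (a + c) * normal_density 0 (sqrt 3) (b - c)))"
proof -
  let ?r = "1 / sqrt (2 * pi)"
  have r3: "(?r ^ 3) powr (2/3) = 1 / (2 * pi)"
    by (simp add: powr_powr power_divide powr_half_sqrt[symmetric] flip: powr_numeral powr_minus_divide)
  have "std_normal_density a * std_normal_density b * std_normal_density c
      = ?r ^ 3 * exp (- (a\<^sup>2 + b\<^sup>2 + c\<^sup>2) / 2)"
    by (simp add: std_normal_density_def power3_eq_cube mult_exp_exp field_simps)
  then have "(std_normal_density a * std_normal_density b * std_normal_density c) powr (2/3)
      = 1 / (2 * pi) * exp (- (a\<^sup>2 + b\<^sup>2 + c\<^sup>2) / 3)"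
    by (simp add: powr_mult r3 exp_powr_real del: power_one_over)
  also have "\<dots> \<le> 1 / (2 * pi) * exp (- (2/9) * (a + c + (b - c) / 2)\<^sup>2 - (b - c)\<^sup>2 / 6)"
  proof -
    \<comment> \<open>The Gaussian was chosen so that its exponent is the minimum of (a^2 + b^2 +
      c^2) / 3 over all triples with the same a + c and b - c. The minimum is attained exactly when
      a - b = c, hence the square that is left over.\<close>
    have "(a\<^sup>2 + b\<^sup>2 + c\<^sup>2) / 3 - (2/9 * (a + c + (b - c) / 2)\<^sup>2 + (b - c)\<^sup>2 / 6) = (a - b - c)\<^sup>2 / 9"
      by (simp add: power2_eq_square field_simps)
    then have "- (a\<^sup>2 + b\<^sup>2 + c\<^sup>2) / 3 \<le> - (2/9) * (a + c + (b - c) / 2)\<^sup>2 - (b - c)\<^sup>2 / 6"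
      using zero_le_power2[of "a - b - c"] by linarith
    then show ?thesis by (intro mult_left_mono) auto
  qed
  also have "\<dots> = 3 * (sqrt 3 / 2 * (normal_density (- (b - c) / 2) (3/2) (a + c) * normal_density 0 (sqrt 3) (b - c)))"
  proof -
    have "sqrt (2 * pi * (3/2)\<^sup>2) = sqrt (2 * pi) * (3/2)" "sqrt (2 * pi * (sqrt 3)\<^sup>2) = sqrt (2 * pi) * sqrt 3"
      by (simp_all only: real_sqrt_mult real_sqrt_abs) simp_all
    note sq = this
    have "normal_density (- (b - c) / 2) (3/2) (a + c) * normal_density 0 (sqrt 3) (b - c)
       = 1 / (sqrt (2 * pi) * (3/2)) * (1 / (sqrt (2 * pi) * sqrt 3)) *
          (exp (- (a + c - (- (b - c) / 2))\<^sup>2 / (2 * (3/2)\<^sup>2)) * exp (- (b - c - 0)\<^sup>2 / (2 * (sqrt 3)\<^sup>2)))"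
      unfolding normal_density_def sq by (simp only: ac_simps)
    also have "1 / (sqrt (2 * pi) * (3/2)) * (1 / (sqrt (2 * pi) * sqrt 3)) = 1 / (2 * pi) * (2 / (3 * sqrt 3))"
      by (simp add: field_simps)
    also have "exp (- (a + c - (- (b - c) / 2))\<^sup>2 / (2 * (3/2)\<^sup>2)) * exp (- (b - c - 0)\<^sup>2 / (2 * (sqrt 3)\<^sup>2))
       = exp (- (2/9) * (a + c + (b - c) / 2)\<^sup>2 - (b - c)\<^sup>2 / 6)"
      unfolding mult_exp_exp by (rule arg_cong[where f = exp]) (simp add: power2_eq_square field_simps)
    finally show ?thesis by (simp add: field_simps)
  qed
  finally show ?thesis .
qed

text \<open>Writing each function as a Gaussian composed with its transport, times the derivative of
  the transport, splits the integrand into a Gaussian part and a derivative part. The first is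
  bounded by \<open>3 * \<phi> (\<theta> z)\<close>, the second by a third of the Jacobian of
  \<open>\<theta>\<close>. The product is thus at most the pullback of \<open>\<phi>\<close>, whose
  total mass is sqrt 3 / 2.\<close>

lemma brascamp_lieb_real_normalized:
  fixes f g h :: "real \<Rightarrow> real"
  assumes f: "continuous_on UNIV f" "\<And>x. 0 < f x" "(\<integral>\<^sup>+x. ennreal (f x) \<partial>lborel) = 1"
    and g: "continuous_on UNIV g" "\<And>x. 0 < g x" "(\<integral>\<^sup>+x. ennreal (g x) \<partial>lborel) = 1"
    and h: "continuous_on UNIV h" "\<And>x. 0 < h x" "(\<integral>\<^sup>+x. ennreal (h x) \<partial>lborel) = 1"
  shows "(\<integral>\<^sup>+x. \<integral>\<^sup>+y. ennreal ((f x * g y * h (x - y)) powr (2/3)) \<partial>lborel \<partial>lborel) \<le> ennreal (sqrt 3 / 2)"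
proof -
  let ?\<gamma> = std_normal_density
  have \<gamma>: "continuous_on UNIV ?\<gamma>" "\<And>x. 0 < ?\<gamma> x" "(\<integral>\<^sup>+x. ennreal (?\<gamma> x) \<partial>lborel) = 1"
    by (auto simp: normal_density_def[abs_def] intro!: continuous_intros)[2]
       (simp add: nn_integral_eq_integral)
  obtain T1 U1 where T1: "\<And>x. (T1 has_real_derivative U1 x) (at x)" "\<And>x. 0 < U1 x"
    "\<And>x. f x = ?\<gamma> (T1 x) * U1 x" using monotone_transport[OF f \<gamma>] by metis
  obtain T2 U2 where T2: "\<And>x. (T2 has_real_derivative U2 x) (at x)" "\<And>x. 0 < U2 x"
    "\<And>x. g x = ?\<gamma> (T2 x) * U2 x" using monotone_transport[OF g \<gamma>] by metis
  obtain T3 U3 where T3: "\<And>x. (T3 has_real_derivative U3 x) (at x)" "\<And>x. 0 < U3 x"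
    "\<And>x. h x = ?\<gamma> (T3 x) * U3 x" using monotone_transport[OF h \<gamma>] by metis
  have mono: "T1 x < T1 y" "T2 x < T2 y" "T3 x < T3 y" if "x < y" for x y
    using DERIV_pos_imp_increasing[OF that] T1(1,2) T2(1,2) T3(1,2) by blast+
  \<comment> \<open>The sum of the transports of the forms x, y, x - y, each multiplied by its coefficient vector.
    It is the gradient of a strictly convex function, hence injective.\<close>
  define \<theta> :: "real^2 \<Rightarrow> real^2" where "\<theta> = (\<lambda>z. (T1 (z$1) + T3 (z$1 - z$2)) *\<^sub>R axis 1 1
     + (T2 (z$2) - T3 (z$1 - z$2)) *\<^sub>R axis 2 1)"
  define \<theta>' :: "real^2 \<Rightarrow> real^2 \<Rightarrow> real^2" where "\<theta>' = (\<lambda>z k. (U1 (z$1) * k$1 + U3 (z$1 - z$2) * (k$1 - k$2)) *\<^sub>R axis 1 1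
     + (U2 (z$2) * k$2 - U3 (z$1 - z$2) * (k$1 - k$2)) *\<^sub>R axis 2 1)"
  define \<phi> :: "real^2 \<Rightarrow> real" where "\<phi> = (\<lambda>w. sqrt 3 / 2 * 
     (normal_density (- (w$2) / 2) (3/2) (w$1) * normal_density 0 (sqrt 3) (w$2)))"
  have \<theta>12: "\<theta> z $ 1 = T1 (z$1) + T3 (z$1 - z$2)" "\<theta> z $ 2 = T2 (z$2) - T3 (z$1 - z$2)" for z
    by (simp_all add: \<theta>_def axis_def)
  have der: "(\<theta> has_derivative \<theta>' z) (at z)" for z
  proof -
    have nth: "((\<lambda>z::real^2. z $ i) has_derivative (\<lambda>k. k $ i)) (at z)" for i
      by (rule bounded_linear_imp_has_derivative) (rule bounded_linear_vec_nth)
    note T' = T1(1)[unfolded has_field_derivative_def] T2(1)[unfolded has_field_derivative_def]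
        T3(1)[unfolded has_field_derivative_def]
    show ?thesis unfolding \<theta>_def \<theta>'_def
      by (intro has_derivative_add has_derivative_diff has_derivative_scaleR_left nth
          has_derivative_compose[OF _ T'(1)] has_derivative_compose[OF _ T'(2)] has_derivative_compose[OF _ T'(3)])
  qed
  have det: "det (matrix (\<theta>' z)) = U1 (z$1) * U2 (z$2) + U2 (z$2) * U3 (z$1 - z$2) + U1 (z$1) * U3 (z$1 - z$2)" for z
    by (simp add: det_2 matrix_def \<theta>'_def axis_def algebra_simps)
  have "inj \<theta>"
  proof (rule injI)
    fix z w assume "\<theta> z = \<theta> w"
    then have e: "T1 (z$1) + T3 (z$1 - z$2) = T1 (w$1) + T3 (w$1 - w$2)"
       "T2 (z$2) - T3 (z$1 - z$2) = T2 (w$2) - T3 (w$1 - w$2)" by (metis \<theta>12)+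
    \<comment> \<open>If \<open>z$1 < w$1\<close>, the first equation gives
      \<open>z$1 - z$2 > w$1 - w$2\<close> and so \<open>z$2 < w$2\<close>, while the second
      equation then gives \<open>z$2 > w$2\<close>. The other cases are alike.\<close>
    have "z$1 = w$1 \<and> z$2 = w$2"
      using mono[of "z$1" "w$1"] mono[of "w$1" "z$1"] mono[of "z$2" "w$2"] mono[of "w$2" "z$2"]
        mono[of "z$1 - z$2" "w$1 - w$2"] mono[of "w$1 - w$2" "z$1 - z$2"] e by argo
    then show "z = w" by (simp add: vec_eq_iff forall_2)
  qed
  have [measurable]: "(\<lambda>z::real^2. z $ i) \<in> borel_measurable borel" for i
    by (intro borel_measurable_continuous_onI continuous_intros)
  have [measurable]: "f \<in> borel_measurable borel" "g \<in> borel_measurable borel" "h \<in> borel_measurable borel"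
    using f g h by (auto intro: borel_measurable_continuous_onI)
  have meas\<phi> [measurable]: "\<phi> \<in> borel_measurable borel"
    unfolding \<phi>_def normal_density_def by measurable
  have nn\<phi>: "0 \<le> \<phi> w" for w by (simp add: \<phi>_def)
  have int\<phi>: "(\<integral>\<^sup>+w. ennreal (\<phi> w) \<partial>lborel) = ennreal (sqrt 3 / 2)"
  proof -
    have "(\<integral>\<^sup>+w. ennreal (\<phi> w) \<partial>lborel) = (\<integral>\<^sup>+p. \<integral>\<^sup>+q. ennreal (sqrt 3 / 2 * 
     (normal_density (- q / 2) (3/2) p * normal_density 0 (sqrt 3) q)) \<partial>lborel \<partial>lborel)"
      by (subst nn_integral_lborel_real2) (measurable, simp add: \<phi>_def axis_def)
    \<comment> \<open>Integrating over \<open>p\<close> first makes the inner integral that of a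
      full normal density whose mean depends on \<open>q\<close>, so it equals 1 for every
      \<open>q\<close>.\<close>
    also have "\<dots> = (\<integral>\<^sup>+q. \<integral>\<^sup>+p. ennreal (sqrt 3 / 2 * 
     (normal_density (- q / 2) (3/2) p * normal_density 0 (sqrt 3) q)) \<partial>lborel \<partial>lborel)"
      unfolding normal_density_def by (rule lborel_pair.Fubini') measurable
    also have "\<dots> = (\<integral>\<^sup>+q. ennreal (sqrt 3 / 2 * normal_density 0 (sqrt 3) q) * 
       (\<integral>\<^sup>+p. ennreal (normal_density (- q / 2) (3/2) p) \<partial>lborel) \<partial>lborel)"
      by (subst nn_integral_cmult[symmetric]) (auto simp: ennreal_mult'[symmetric] ac_simps)
    also have "\<dots> = ennreal (sqrt 3 / 2)"
      by (simp add: nn_integral_eq_integral ennreal_mult' nn_integral_cmult)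
    finally show ?thesis .
  qed
  have "(\<integral>\<^sup>+x. \<integral>\<^sup>+y. ennreal ((f x * g y * h (x - y)) powr (2/3)) \<partial>lborel \<partial>lborel) 
     = (\<integral>\<^sup>+z. ennreal ((f ((z::real^2)$1) * g (z$2) * h (z$1 - z$2)) powr (2/3)) \<partial>lborel)"
    by (subst nn_integral_lborel_real2) (simp_all add: axis_def)
  also have "\<dots> \<le> (\<integral>\<^sup>+z. ennreal (\<bar>det (matrix (\<theta>' z))\<bar> * \<phi> (\<theta> z)) \<partial>lborel)"
  proof (intro nn_integral_mono ennreal_leI)
    fix z :: "real^2"
    let ?a = "T1 (z$1)" and ?b = "T2 (z$2)" and ?c = "T3 (z$1 - z$2)"
    let ?u = "U1 (z$1)" and ?v = "U2 (z$2)" and ?w = "U3 (z$1 - z$2)"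
    have U: "0 < ?u" "0 < ?v" "0 < ?w" using T1 T2 T3 by auto
    have "(f (z$1) * g (z$2) * h (z$1 - z$2)) powr (2/3) = ((?\<gamma> ?a * ?\<gamma> ?b * ?\<gamma> ?c) * (?u * ?v * ?w)) powr (2/3)"
      by (simp add: T1 T2 T3 ac_simps)
    also have "\<dots> = (?\<gamma> ?a * ?\<gamma> ?b * ?\<gamma> ?c) powr (2/3) * (?u * ?v * ?w) powr (2/3)"
      by (rule powr_mult)
    \<comment> \<open>The factor 3 lost in the Gaussian comparison is exactly the one that AM-GM
      returns.\<close>
    also have "\<dots> \<le> (3 * \<phi> (\<theta> z)) * (?u * ?v * ?w) powr (2/3)"
      unfolding \<phi>_def \<theta>12 by (intro mult_right_mono std_normal_density_prod_le; simp)
    also have "\<dots> = \<phi> (\<theta> z) * (3 * (?u * ?v * ?w) powr (2/3))" by simp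
    also have "\<dots> \<le> \<phi> (\<theta> z) * det (matrix (\<theta>' z))"
      unfolding det by (intro mult_left_mono arith_geo_mean_pairs U nn\<phi>)
    also have "\<dots> \<le> \<bar>det (matrix (\<theta>' z))\<bar> * \<phi> (\<theta> z)"
      by (metis abs_ge_self mult.commute mult_left_mono nn\<phi>)
    finally show "(f (z$1) * g (z$2) * h (z$1 - z$2)) powr (2/3) \<le> \<bar>det (matrix (\<theta>' z))\<bar> * \<phi> (\<theta> z)" .
  qed
  also have "\<dots> \<le> (\<integral>\<^sup>+w. ennreal (\<phi> w) \<partial>lborel)"
  proof (rule nn_integral_change_of_variables_le[OF der \<open>inj \<theta>\<close> _ nn\<phi>])
    show "integrable lborel \<phi>"
      by (rule integrableI_nonneg) (auto simp: nn\<phi> int\<phi>)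
  qed
  finally show ?thesis unfolding int\<phi> .
qed

section \<open>Passing from positive continuous densities to bounded functions of compact
  support\<close>

lemma lborel_integral_pos:
  fixes f :: "real \<Rightarrow> real"
  assumes "integrable lborel f" "\<And>x. 0 < f x"
  shows "0 < integral\<^sup>L lborel f"
proof -
  have "integral\<^sup>L lborel f \<noteq> 0"
  proof
    assume "integral\<^sup>L lborel f = 0"
    then have "AE x in lborel. f x = 0"
      using assms by (subst (asm) integral_nonneg_eq_0_iff_AE) (auto intro: less_imp_le)
    then have "AE x in (lborel :: real measure). False"
      by (rule AE_mp) (use assms(2) in \<open>auto intro!: AE_I2 simp: less_imp_neq[symmetric]\<close>)
    then show False
      by (simp add: AE_iff_null null_sets_def)
  qed
  moreover have "0 \<le> integral\<^sup>L lborel f" using assms(2) by (intro Bochner_Integration.integral_nonneg) (simp add: less_imp_le)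
  ultimately show ?thesis by simp
qed

text \<open>Both sides are homogeneous of degree 2/3 in each function, so all three may be divided
  by their integrals, which are positive.\<close>

lemma brascamp_lieb_real_continuous:
  fixes f g h :: "real \<Rightarrow> real"
  assumes f: "continuous_on UNIV f" "\<And>x. 0 < f x" "integrable lborel f"
    and g: "continuous_on UNIV g" "\<And>x. 0 < g x" "integrable lborel g"
    and h: "continuous_on UNIV h" "\<And>x. 0 < h x" "integrable lborel h"
  shows "(\<integral>\<^sup>+x. \<integral>\<^sup>+y. ennreal ((f x * g y * h (x - y)) powr (2/3)) \<partial>lborel \<partial>lborel)
    \<le> ennreal (sqrt 3 / 2 * (integral\<^sup>L lborel f * integral\<^sup>L lborel g * integral\<^sup>L lborel h) powr (2/3))"
proof -
  let ?F = "integral\<^sup>L lborel f" and ?G = "integral\<^sup>L lborel g" and ?H = "integral\<^sup>L lborel h"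
  have pos: "0 < ?F" "0 < ?G" "0 < ?H" using f g h by (auto intro: lborel_integral_pos)
  have nrm: "continuous_on UNIV (\<lambda>x. u x / integral\<^sup>L lborel u)" "\<And>x. 0 < u x / integral\<^sup>L lborel u"
    "(\<integral>\<^sup>+x. ennreal (u x / integral\<^sup>L lborel u) \<partial>lborel) = 1"
    if "continuous_on UNIV u" "\<And>x. 0 < u x" "integrable lborel u" for u :: "real \<Rightarrow> real"
  proof -
    have "0 < integral\<^sup>L lborel u" using that lborel_integral_pos by blast
    then show "continuous_on UNIV (\<lambda>x. u x / integral\<^sup>L lborel u)" "\<And>x. 0 < u x / integral\<^sup>L lborel u"
      "(\<integral>\<^sup>+x. ennreal (u x / integral\<^sup>L lborel u) \<partial>lborel) = 1"
      using that by (auto intro!: continuous_intros simp: nn_integral_eq_integral less_imp_le)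
  qed
  have [measurable]: "f \<in> borel_measurable borel" "g \<in> borel_measurable borel" "h \<in> borel_measurable borel"
    using f g h by (auto intro: borel_measurable_continuous_onI)
  have "(f x * g y * h (x - y)) powr (2/3) = (?F * ?G * ?H) powr (2/3) *
     (f x / ?F * (g y / ?G) * (h (x - y) / ?H)) powr (2/3)" for x y
    using pos f g h by (subst powr_mult[symmetric]) (auto simp: less_imp_le)
  then have "(\<integral>\<^sup>+x. \<integral>\<^sup>+y. ennreal ((f x * g y * h (x - y)) powr (2/3)) \<partial>lborel \<partial>lborel)
    = ennreal ((?F * ?G * ?H) powr (2/3)) * (\<integral>\<^sup>+x. \<integral>\<^sup>+y. ennreal ((f x / ?F * (g y / ?G) * (h (x - y) / ?H)) powr (2/3)) \<partial>lborel \<partial>lborel)"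
    by (simp add: ennreal_mult' nn_integral_cmult)
  also have "\<dots> \<le> ennreal ((?F * ?G * ?H) powr (2/3)) * ennreal (sqrt 3 / 2)"
    by (intro mult_left_mono brascamp_lieb_real_normalized nrm f g h) auto
  finally show ?thesis by (simp add: ennreal_mult'[symmetric] mult.commute)
qed

text \<open>Transport requires positive continuous densities, whereas indicators and their partial
  integrals are neither. The approximants share one integrable majorant, so their integrals converge
  as well.\<close>

lemma continuous_positive_approximation:
  fixes f :: "real \<Rightarrow> real"
  assumes fm [measurable]: "f \<in> borel_measurable borel" and bd: "\<And>x. 0 \<le> f x" "\<And>x. f x \<le> B"
    and supp: "\<And>x. R < \<bar>x\<bar> \<Longrightarrow> f x = 0"
  obtains u where "\<And>n::nat. continuous_on UNIV (u n)" "\<And>n x. 0 < u n x" "\<And>n. integrable lborel (u n)"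
    "AE x in lborel. (\<lambda>n. u n x) \<longlonglongrightarrow> f x" "(\<lambda>n. integral\<^sup>L lborel (u n)) \<longlonglongrightarrow> integral\<^sup>L lborel f"
proof -
  have "f measurable_on UNIV"
    by (rule lebesgue_measurable_imp_measurable_on_nnreal_UNIV) (use bd in \<open>auto intro: measurable_completion\<close>)
  then obtain N w where N: "negligible N" and w: "\<And>n. continuous_on UNIV (w n)"
    "\<And>x. x \<notin> N \<Longrightarrow> (\<lambda>n. w n x) \<longlonglongrightarrow> f x"
    unfolding measurable_on_def by auto
  define \<gamma> where "\<gamma> = std_normal_density"
  have \<gamma>: "continuous_on UNIV \<gamma>" "0 < \<gamma> x" "integrable lborel \<gamma>" for x
    unfolding \<gamma>_def by (auto simp: normal_density_def[abs_def] intro!: continuous_intros)[2] simp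
  \<comment> \<open>Clipping to the range from 0 to \<open>B\<close> and multiplying by a tent equal
    to 1 on the support provides the majorant; the vanishing multiple of a Gaussian provides strict
    positivity.\<close>
  define u where "u = (\<lambda>n x. max 0 (min B (w n x)) * max 0 (min 1 (R + 1 - \<bar>x\<bar>)) + \<gamma> x / Suc n)"
  define b where "b = (\<lambda>x. B * indicator {-R-1..R+1} x + \<gamma> x)"
  have B0: "0 \<le> B" using bd[of 0] by simp
  have cont: "continuous_on UNIV (u n)" for n
    unfolding u_def by (intro continuous_intros w \<gamma>) auto
  have pos: "0 < u n x" for n x
    unfolding u_def by (intro add_nonneg_pos) (auto simp: \<gamma>)
  have bint: "integrable lborel b"
    unfolding b_def by (intro Bochner_Integration.integrable_add integrable_mult_right \<gamma>
        integrable_real_indicator emeasure_compact_finite) simp_all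
  have le: "norm (u n x) \<le> b x" for n x
  proof -
    have "max 0 (min B (w n x)) * max 0 (min 1 (R + 1 - \<bar>x\<bar>)) \<le> B * indicator {-R-1..R+1} x"
    proof (cases "\<bar>x\<bar> \<le> R + 1")
      case True
      then have "x \<in> {-R-1..R+1}" by auto
      then show ?thesis using B0 mult_mono[of "max 0 (min B (w n x))" B "max 0 (min 1 (R + 1 - \<bar>x\<bar>))" 1]
        by simp
    qed (auto simp: max_def B0)
    moreover have "\<gamma> x / Suc n \<le> \<gamma> x" using \<gamma>(2)[of x] by (simp add: field_simps)
    ultimately have "u n x \<le> b x" unfolding b_def u_def by (rule add_mono)
    then show ?thesis using pos[of n x] by simp
  qed
  have um [measurable]: "u n \<in> borel_measurable borel" for n
    using cont by (rule borel_measurable_continuous_onI)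
  have lim: "(\<lambda>n. u n x) \<longlonglongrightarrow> f x" if "x \<notin> N" for x
  proof -
    have "(\<lambda>n. u n x) \<longlonglongrightarrow> max 0 (min B (f x)) * max 0 (min 1 (R + 1 - \<bar>x\<bar>)) + 0"
      unfolding u_def by (intro tendsto_add tendsto_mult tendsto_max tendsto_min tendsto_const
          w(2)[OF that] lim_const_over_n[THEN LIMSEQ_Suc])
    also have "max 0 (min B (f x)) * max 0 (min 1 (R + 1 - \<bar>x\<bar>)) + 0 = f x"
      using bd[of x] supp[of x] by (cases "\<bar>x\<bar> \<le> R") auto
    finally show ?thesis .
  qed
  from N have "AE x in lebesgue. x \<notin> N"
    using negligible_iff_null_sets AE_not_in by blast
  then have "AE x in lebesgue. (\<lambda>n. u n x) \<longlonglongrightarrow> f x"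
    using lim by (rule eventually_mono)
  then have AE: "AE x in lborel. (\<lambda>n. u n x) \<longlonglongrightarrow> f x"
    by (simp only: AE_completion_iff)
  have "(\<lambda>n. integral\<^sup>L lborel (u n)) \<longlonglongrightarrow> integral\<^sup>L lborel f"
    by (rule integral_dominated_convergence[OF _ _ bint AE]) (simp_all add: le[unfolded real_norm_def])
  moreover have "integrable lborel (u n)" for n
  proof (rule Bochner_Integration.integrable_bound[OF bint])
    show "AE x in lborel. norm (u n x) \<le> norm (b x)"
      using order_trans[OF le abs_ge_self] by simp
  qed simp
  ultimately show ?thesis by (intro that[OF cont pos _ AE])
qed

text \<open>The exceptional null set of the approximants of the third function lives in the variable
  x - y. For fixed x it has to be moved to the variable y.\<close>

lemma AE_lborel_diff:
  fixes x :: real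
  assumes "AE y in lborel. P y"
  shows "AE y in lborel. P (x - y)"
proof -
  have "lborel = distr lborel borel (\<lambda>y. x - y)"
    using lborel_real_affine[of "-1" x] by (simp add: density_1 one_ennreal_def[symmetric])
  then have "AE y in distr lborel borel (\<lambda>y. x - y). P y" using assms by metis
  then show ?thesis by (rule AE_distrD[rotated]) simp
qed

text \<open>Fatou's lemma, once for each integral, suffices on the left because only an upper bound
  is wanted; the right-hand sides converge with the integrals of the approximants.\<close>

lemma brascamp_lieb_real:
  fixes f g h :: "real \<Rightarrow> real"
  assumes f: "f \<in> borel_measurable borel" "\<And>x. 0 \<le> f x" "\<And>x. f x \<le> B" "\<And>x. R < \<bar>x\<bar> \<Longrightarrow> f x = 0"
    and g: "g \<in> borel_measurable borel" "\<And>x. 0 \<le> g x" "\<And>x. g x \<le> B" "\<And>x. R < \<bar>x\<bar> \<Longrightarrow> g x = 0"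
    and h: "h \<in> borel_measurable borel" "\<And>x. 0 \<le> h x" "\<And>x. h x \<le> B" "\<And>x. R < \<bar>x\<bar> \<Longrightarrow> h x = 0"
  shows "(\<integral>\<^sup>+x. \<integral>\<^sup>+y. ennreal ((f x * g y * h (x - y)) powr (2/3)) \<partial>lborel \<partial>lborel)
    \<le> ennreal (sqrt 3 / 2 * (integral\<^sup>L lborel f * integral\<^sup>L lborel g * integral\<^sup>L lborel h) powr (2/3))"
proof -
  obtain u where u: "\<And>n::nat. continuous_on UNIV (u n)" "\<And>n x. 0 < u n x" "\<And>n. integrable lborel (u n)"
    "AE x in lborel. (\<lambda>n. u n x) \<longlonglongrightarrow> f x" "(\<lambda>n. integral\<^sup>L lborel (u n)) \<longlonglongrightarrow> integral\<^sup>L lborel f"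
    using continuous_positive_approximation[OF f] by blast
  obtain v where v: "\<And>n::nat. continuous_on UNIV (v n)" "\<And>n x. 0 < v n x" "\<And>n. integrable lborel (v n)"
    "AE x in lborel. (\<lambda>n. v n x) \<longlonglongrightarrow> g x" "(\<lambda>n. integral\<^sup>L lborel (v n)) \<longlonglongrightarrow> integral\<^sup>L lborel g"
    using continuous_positive_approximation[OF g] by blast
  obtain w where w: "\<And>n::nat. continuous_on UNIV (w n)" "\<And>n x. 0 < w n x" "\<And>n. integrable lborel (w n)"
    "AE x in lborel. (\<lambda>n. w n x) \<longlonglongrightarrow> h x" "(\<lambda>n. integral\<^sup>L lborel (w n)) \<longlonglongrightarrow> integral\<^sup>L lborel h"
    using continuous_positive_approximation[OF h] by blast
  have [measurable]: "u n \<in> borel_measurable borel" "v n \<in> borel_measurable borel" "w n \<in> borel_measurable borel" for n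
    using u v w by (auto intro: borel_measurable_continuous_onI)
  note [measurable] = f(1) g(1) h(1)
  let ?I = "\<lambda>n x y. ennreal ((u n x * v n y * w n (x - y)) powr (2/3))"
  let ?b = "\<lambda>F G H. ennreal (sqrt 3 / 2 * (F * G * H) powr (2/3))"
  have "(\<integral>\<^sup>+x. \<integral>\<^sup>+y. ennreal ((f x * g y * h (x - y)) powr (2/3)) \<partial>lborel \<partial>lborel)
    = (\<integral>\<^sup>+x. \<integral>\<^sup>+y. liminf (\<lambda>n. ?I n x y) \<partial>lborel \<partial>lborel)"
  proof (rule nn_integral_cong_AE, rule AE_mp[OF u(4)], rule AE_I2, rule impI)
    fix x assume ux: "(\<lambda>n. u n x) \<longlonglongrightarrow> f x"
    show "(\<integral>\<^sup>+y. ennreal ((f x * g y * h (x - y)) powr (2/3)) \<partial>lborel) = (\<integral>\<^sup>+y. liminf (\<lambda>n. ?I n x y) \<partial>lborel)"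
    proof (rule nn_integral_cong_AE, use v(4) AE_lborel_diff[OF w(4), of x] in eventually_elim)
      case (elim y)
      have "(\<lambda>n. ?I n x y) \<longlonglongrightarrow> ennreal ((f x * g y * h (x - y)) powr (2/3))"
        by (intro tendsto_ennrealI tendsto_powr' tendsto_mult ux elim tendsto_const)
            (auto intro!: always_eventually less_imp_le mult_pos_pos u v w)
      then show ?case by (rule lim_imp_Liminf[OF trivial_limit_sequentially, symmetric])
    qed
  qed
  also have "\<dots> \<le> (\<integral>\<^sup>+x. liminf (\<lambda>n. \<integral>\<^sup>+y. ?I n x y \<partial>lborel) \<partial>lborel)"
    by (intro nn_integral_mono nn_integral_liminf) measurable
  also have "\<dots> \<le> liminf (\<lambda>n. \<integral>\<^sup>+x. \<integral>\<^sup>+y. ?I n x y \<partial>lborel \<partial>lborel)"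
    by (intro nn_integral_liminf) measurable
  also have "\<dots> \<le> liminf (\<lambda>n. ?b (integral\<^sup>L lborel (u n)) (integral\<^sup>L lborel (v n)) (integral\<^sup>L lborel (w n)))"
    by (intro Liminf_mono always_eventually allI brascamp_lieb_real_continuous u v w)
  also have "\<dots> = ?b (integral\<^sup>L lborel f) (integral\<^sup>L lborel g) (integral\<^sup>L lborel h)"
    by (intro lim_imp_Liminf tendsto_ennrealI tendsto_mult tendsto_powr' u v w tendsto_const)
      (auto intro!: always_eventually less_imp_le mult_pos_pos lborel_integral_pos u v w)
  finally show ?thesis .
qed

section \<open>Tensorization\<close>

abbreviation lebesgue_PiM :: "'i set \<Rightarrow> ('i \<Rightarrow> real) measure" where
  "lebesgue_PiM I \<equiv> Pi\<^sub>M I (\<lambda>_. lborel)"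

interpretation lborel_PiM: product_sigma_finite "\<lambda>_. lborel :: real measure"
  by standard

text \<open>A class that contains the indicators of bounded regions and is stable under integrating
  out a coordinate. Doing so keeps \<open>R\<close> and multiplies \<open>B\<close> by the length of
  an interval, which is why the induction generalizes over \<open>B\<close> alone. The conditions
  are confined to the space because the product measure lives on functions that are undefined off
  \<open>I\<close>.\<close>

definition box_supported :: "'i set \<Rightarrow> real \<Rightarrow> real \<Rightarrow> (('i \<Rightarrow> real) \<Rightarrow> real) \<Rightarrow> bool" where
  "box_supported I B R f \<longleftrightarrow> f \<in> borel_measurable (lebesgue_PiM I) \<and>
     (\<forall>x\<in>space (lebesgue_PiM I). 0 \<le> f x \<and> f x \<le> B \<and> (\<forall>i\<in>I. R < \<bar>x i\<bar> \<longrightarrow> f x = 0))"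

lemma box_supported_integrable:
  assumes "finite I" "box_supported I B R f"
  shows "integrable (lebesgue_PiM I) f"
proof (rule Bochner_Integration.integrable_bound)
  let ?Q = "Pi\<^sub>E I (\<lambda>_. {-R..R})"
  have Q: "?Q \<in> sets (lebesgue_PiM I)" using assms(1) by (intro sets_PiM_I_finite) auto
  have "emeasure (lebesgue_PiM I) ?Q = (\<Prod>i\<in>I. emeasure lborel {-R..R})"
    using assms(1) by (intro lborel_PiM.emeasure_PiM) auto
  also have "\<dots> < \<infinity>"
    using emeasure_compact_finite[of "{-R..R}"] by (simp add: power_less_top_ennreal)
  finally show "integrable (lebesgue_PiM I) (\<lambda>x. B * indicator ?Q x :: real)"
    using Q by (intro integrable_mult_right integrable_real_indicator)
  show "f \<in> borel_measurable (lebesgue_PiM I)" using assms by (simp add: box_supported_def)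
  show "AE x in lebesgue_PiM I. norm (f x) \<le> norm (B * indicator ?Q x :: real)"
  proof (rule AE_I2)
    fix x assume x: "x \<in> space (lebesgue_PiM I)"
    show "norm (f x) \<le> norm (B * indicator ?Q x :: real)"
    proof (cases "x \<in> ?Q")
      case True
      then show ?thesis using assms x by (auto simp: box_supported_def)
    next
      case False
      then have "\<exists>i\<in>I. x i \<notin> {-R..R}"
        using x by (simp add: space_PiM PiE_iff)
      then obtain i where "i \<in> I" "R < \<bar>x i\<bar>" by fastforce
      then show ?thesis using assms x by (auto simp: box_supported_def)
    qed
  qed
qed

lemma measurable_fun_upd_const:
  assumes "i \<notin> I" "x \<in> space (lebesgue_PiM I)"
  shows "(\<lambda>t. x(i := t)) \<in> measurable borel (lebesgue_PiM (insert i I))"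
proof -
  have "(\<lambda>(f, y). f(i := y)) \<circ> Pair x \<in> measurable lborel (lebesgue_PiM (insert i I))"
    by (rule measurable_comp[OF measurable_Pair1'[OF assms(2)] measurable_add_dim])
  then show ?thesis by (simp add: comp_def)
qed

lemma box_supported_fiber:
  assumes "box_supported (insert i I) B R f" "i \<notin> I" "x \<in> space (lebesgue_PiM I)"
  shows "(\<lambda>t. f (x(i := t))) \<in> borel_measurable borel"
    "0 \<le> f (x(i := t))" "f (x(i := t)) \<le> B" "R < \<bar>t\<bar> \<Longrightarrow> f (x(i := t)) = 0"
proof -
  have "f \<in> borel_measurable (lebesgue_PiM (insert i I))" using assms by (simp add: box_supported_def)
  then show "(\<lambda>t. f (x(i := t))) \<in> borel_measurable borel"
    by (rule measurable_compose[OF measurable_fun_upd_const[OF assms(2,3)]])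
  have "x(i := t) \<in> space (lebesgue_PiM (insert i I))"
    using assms by (auto simp: space_PiM PiE_def extensional_def)
  then show "0 \<le> f (x(i := t))" "f (x(i := t)) \<le> B" "R < \<bar>t\<bar> \<Longrightarrow> f (x(i := t)) = 0"
    using assms by (auto simp: box_supported_def)
qed

lemma box_supported_fiber_integral:
  assumes "finite I" "i \<notin> I" and f: "box_supported (insert i I) B R f"
  shows "box_supported I (B * measure lborel {-R..R}) R (\<lambda>x. \<integral>t. f (x(i := t)) \<partial>lborel)"
    "integral\<^sup>L (lebesgue_PiM I) (\<lambda>x. \<integral>t. f (x(i := t)) \<partial>lborel) = integral\<^sup>L (lebesgue_PiM (insert i I)) f"
proof -
  have [measurable]: "f \<in> borel_measurable (lebesgue_PiM (insert i I))" using f by (simp add: box_supported_def)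
  show "integral\<^sup>L (lebesgue_PiM I) (\<lambda>x. \<integral>t. f (x(i := t)) \<partial>lborel) = integral\<^sup>L (lebesgue_PiM (insert i I)) f"
    using lborel_PiM.product_integral_insert[OF assms(1,2) box_supported_integrable[OF _ f]] assms(1) by simp
  have "(\<lambda>(x, t). f (x(i := t))) \<in> borel_measurable (lebesgue_PiM I \<Otimes>\<^sub>M lborel)"
    using measurable_compose[OF measurable_add_dim[of i I "\<lambda>_. lborel"], of f] by (simp add: split_beta')
  then have meas: "(\<lambda>x. \<integral>t. f (x(i := t)) \<partial>lborel) \<in> borel_measurable (lebesgue_PiM I)"
    by (rule lborel.borel_measurable_lebesgue_integral)
  have "(\<integral>t. f (x(i := t)) \<partial>lborel) \<le> B * measure lborel {-R..R}" if x: "x \<in> space (lebesgue_PiM I)" for x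
  proof -
    have "(\<integral>t. f (x(i := t)) \<partial>lborel) \<le> (\<integral>t. B * indicator {-R..R} t \<partial>lborel)"
    proof (rule integral_mono')
      show "integrable lborel (\<lambda>t. B * indicator {-R..R} t :: real)"
        by (intro integrable_mult_right integrable_real_indicator emeasure_compact_finite) auto
      show "f (x(i := t)) \<le> B * indicator {-R..R} t" for t
        using box_supported_fiber(3,4)[OF f assms(2) x, of t] by (cases "R < \<bar>t\<bar>") (auto simp: indicator_def abs_if split: if_splits)
      show "0 \<le> B * indicator {-R..R} t" for t :: real
        using box_supported_fiber(2,3)[OF f assms(2) x, of t] by (simp add: indicator_def)
    qed
    then show ?thesis by simp
  qed
  moreover have "0 \<le> (\<integral>t. f (x(i := t)) \<partial>lborel)" if x: "x \<in> space (lebesgue_PiM I)" for x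
    using box_supported_fiber(2)[OF f assms(2) x] by simp
  moreover have "(\<integral>t. f (x(i := t)) \<partial>lborel) = 0" if x: "x \<in> space (lebesgue_PiM I)" "j \<in> I" "R < \<bar>x j\<bar>" for x j
  proof -
    have "f (x(i := t)) = 0" for t
    proof -
      have "x(i := t) \<in> space (lebesgue_PiM (insert i I))"
        using x assms(2) by (auto simp: space_PiM PiE_def extensional_def)
      moreover have "(x(i := t)) j = x j" using x(2) assms(2) by auto
      ultimately show ?thesis using f x(2,3) by (metis box_supported_def insertI2)
    qed
    then show ?thesis by simp
  qed
  ultimately show "box_supported I (B * measure lborel {-R..R}) R (\<lambda>x. \<integral>t. f (x(i := t)) \<partial>lborel)"
    using meas by (auto simp: box_supported_def)
qed

lemma measurable_restrict_diff [measurable]: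
  "(\<lambda>(x, y). \<lambda>i\<in>I. x i - y i) \<in> measurable (lebesgue_PiM I \<Otimes>\<^sub>M lebesgue_PiM I) (lebesgue_PiM I)"
  by (auto simp: split_beta' intro!: measurable_restrict)

text \<open>The bound on the line has the same shape as the integrand, the power 2/3 of a product of
  functions of x, y and x - y. It can therefore be fed straight into the induction hypothesis, and
  every coordinate contributes one factor sqrt 3 / 2.\<close>

theorem brascamp_lieb_PiM:
  assumes "finite I" "box_supported I B R f" "box_supported I B R g" "box_supported I B R h"
  shows "(\<integral>\<^sup>+x. \<integral>\<^sup>+y. ennreal ((f x * g y * h (\<lambda>i\<in>I. x i - y i)) powr (2/3)) \<partial>lebesgue_PiM I \<partial>lebesgue_PiM I)
    \<le> ennreal ((sqrt 3 / 2) ^ card I * (integral\<^sup>L (lebesgue_PiM I) f * integral\<^sup>L (lebesgue_PiM I) g * integral\<^sup>L (lebesgue_PiM I) h) powr (2/3))"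
  using assms
proof (induction I arbitrary: B f g h)
  case empty
  show ?case by (simp add: PiM_empty nn_integral_count_space_finite lebesgue_integral_count_space_finite restrict_def)
next
  case (insert i I)
  note f = \<open>box_supported (insert i I) B R f\<close> and g = \<open>box_supported (insert i I) B R g\<close> and h = \<open>box_supported (insert i I) B R h\<close>
  let ?N = "lebesgue_PiM I" and ?N' = "lebesgue_PiM (insert i I)"
  let ?F = "\<lambda>f x. \<integral>t. f (x(i := t)) \<partial>lborel"
  interpret N: sigma_finite_measure ?N using insert by (intro lborel_PiM.sigma_finite)
  interpret N': sigma_finite_measure ?N' using insert by (intro lborel_PiM.sigma_finite) simp
  interpret P: pair_sigma_finite lborel ?N by standard
  have [measurable]: "f \<in> borel_measurable ?N'" "g \<in> borel_measurable ?N'" "h \<in> borel_measurable ?N'"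
    using f g h by (auto simp: box_supported_def)
  have upd [measurable]: "(\<lambda>p. (u p)(i := v p)) \<in> measurable M ?N'"
    if "u \<in> measurable M ?N" "v \<in> measurable M lborel" for u v and M :: "'z measure"
    using measurable_compose[OF measurable_Pair[OF that] measurable_add_dim[of i I "\<lambda>_. lborel"]] by simp
  have diff [measurable]: "(\<lambda>p. \<lambda>j\<in>insert i I. u p j - v p j) \<in> measurable M ?N'"
    if "u \<in> measurable M ?N'" "v \<in> measurable M ?N'" for u v and M :: "'z measure"
    using measurable_compose[OF measurable_Pair[OF that] measurable_restrict_diff[of "insert i I"]] by simp
  let ?E = "\<lambda>x y. ennreal ((f x * g y * h (\<lambda>j\<in>insert i I. x j - y j)) powr (2/3))"
  have Em: "(\<lambda>p. ?E (u p) (v p)) \<in> borel_measurable M"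
    if [measurable]: "u \<in> measurable M ?N'" "v \<in> measurable M ?N'" for u v and M :: "'z measure"
    by measurable
  \<comment> \<open>On a fiber the third argument moves only in coordinate \<open>i\<close>, by
    \<open>s - t\<close>: this is the configuration of the inequality on the line.\<close>
  have upd_diff: "(\<lambda>j\<in>insert i I. (x(i := s)) j - (y(i := t)) j) = (\<lambda>j\<in>I. x j - y j)(i := s - t)" for x y :: "'a \<Rightarrow> real" and s t
    using insert(2) by (auto simp: fun_eq_iff restrict_def)
  have Em2: "(\<lambda>x. \<integral>\<^sup>+y. ?E x y \<partial>?N') \<in> borel_measurable ?N'"
    using Em[OF measurable_fst measurable_snd] by (intro N'.borel_measurable_nn_integral) (simp add: split_beta')
  have "(\<integral>\<^sup>+x. \<integral>\<^sup>+y. ?E x y \<partial>?N' \<partial>?N') = (\<integral>\<^sup>+x. \<integral>\<^sup>+s. \<integral>\<^sup>+y. ?E (x(i := s)) y \<partial>?N' \<partial>lborel \<partial>?N)"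
    by (rule lborel_PiM.product_nn_integral_insert[OF insert(1,2) Em2])
  also have "\<dots> = (\<integral>\<^sup>+x. \<integral>\<^sup>+s. \<integral>\<^sup>+y. \<integral>\<^sup>+t. ?E (x(i := s)) (y(i := t)) \<partial>lborel \<partial>?N \<partial>lborel \<partial>?N)"
  proof (intro nn_integral_cong lborel_PiM.product_nn_integral_insert[OF insert(1,2)] Em)
    fix x s assume "x \<in> space ?N"
    then show "(\<lambda>y. x(i := s)) \<in> measurable ?N' ?N'"
      using insert(2) by (auto simp: space_PiM PiE_def extensional_def)
  qed measurable
  \<comment> \<open>Exchanging \<open>s\<close> with \<open>y\<close> brings both copies of
    coordinate \<open>i\<close> innermost, with all other coordinates frozen.\<close>
  also have "\<dots> = (\<integral>\<^sup>+x. \<integral>\<^sup>+y. \<integral>\<^sup>+s. \<integral>\<^sup>+t. ?E (x(i := s)) (y(i := t)) \<partial>lborel \<partial>lborel \<partial>?N \<partial>?N)"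
  proof (intro nn_integral_cong P.Fubini'[symmetric])
    fix x assume x: "x \<in> space ?N"
    then have [measurable]: "(\<lambda>_. x) \<in> measurable M ?N" for M :: "'z measure" by simp
    have "(\<lambda>(p, t). ?E (x(i := fst p)) ((snd p)(i := t))) \<in> borel_measurable ((lborel \<Otimes>\<^sub>M ?N) \<Otimes>\<^sub>M lborel)"
      unfolding split_beta' by (intro Em upd) (use x in measurable)
    from lborel.borel_measurable_nn_integral[OF this]
    show "(\<lambda>(s, y). \<integral>\<^sup>+t. ?E (x(i := s)) (y(i := t)) \<partial>lborel) \<in> borel_measurable (lborel \<Otimes>\<^sub>M ?N)"
      unfolding split_beta' .
  qed
  also have "\<dots> \<le> (\<integral>\<^sup>+x. \<integral>\<^sup>+y. ennreal (sqrt 3 / 2 * (?F f x * ?F g y * ?F h (\<lambda>j\<in>I. x j - y j)) powr (2/3)) \<partial>?N \<partial>?N)"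
  proof (intro nn_integral_mono)
    fix x y assume xy: "x \<in> space ?N" "y \<in> space ?N"
    then have d: "(\<lambda>j\<in>I. x j - y j) \<in> space ?N" by (auto simp: space_PiM)
    show "(\<integral>\<^sup>+s. \<integral>\<^sup>+t. ?E (x(i := s)) (y(i := t)) \<partial>lborel \<partial>lborel)
       \<le> ennreal (sqrt 3 / 2 * (?F f x * ?F g y * ?F h (\<lambda>j\<in>I. x j - y j)) powr (2/3))"
      unfolding upd_diff
      by (intro brascamp_lieb_real[where B = B and R = R] box_supported_fiber[OF f insert(2) xy(1)] box_supported_fiber[OF g insert(2) xy(2)]
          box_supported_fiber[OF h insert(2) d])
  qed
  also have "\<dots> = ennreal (sqrt 3 / 2) * (\<integral>\<^sup>+x. \<integral>\<^sup>+y. ennreal ((?F f x * ?F g y * ?F h (\<lambda>j\<in>I. x j - y j)) powr (2/3)) \<partial>?N \<partial>?N)"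
  proof -
    have [measurable]: "?F f \<in> borel_measurable ?N" "?F g \<in> borel_measurable ?N" "?F h \<in> borel_measurable ?N"
      using box_supported_fiber_integral(1)[OF insert(1,2)] f g h by (auto simp: box_supported_def)
    have [measurable]: "(\<lambda>p. \<lambda>j\<in>I. u p j - v p j) \<in> measurable M ?N"
      if "u \<in> measurable M ?N" "v \<in> measurable M ?N" for u v and M :: "'z measure"
      using measurable_compose[OF measurable_Pair[OF that] measurable_restrict_diff[of I]] by simp
    let ?P = "\<lambda>x y. ennreal ((?F f x * ?F g y * ?F h (\<lambda>j\<in>I. x j - y j)) powr (2/3))"
    have "(\<lambda>(x, y). ?P x y) \<in> borel_measurable (?N \<Otimes>\<^sub>M ?N)" by measurable
    then have outer: "(\<lambda>x. \<integral>\<^sup>+y. ?P x y \<partial>?N) \<in> borel_measurable ?N"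
      by (rule N.borel_measurable_nn_integral)
    have inner: "?P x \<in> borel_measurable ?N" if "x \<in> space ?N" for x
      using that by measurable
    have "(\<integral>\<^sup>+x. \<integral>\<^sup>+y. ennreal (sqrt 3 / 2 * (?F f x * ?F g y * ?F h (\<lambda>j\<in>I. x j - y j)) powr (2/3)) \<partial>?N \<partial>?N)
      = (\<integral>\<^sup>+x. \<integral>\<^sup>+y. ennreal (sqrt 3 / 2) * ?P x y \<partial>?N \<partial>?N)"
      by (intro nn_integral_cong ennreal_mult) auto
    also have "\<dots> = (\<integral>\<^sup>+x. ennreal (sqrt 3 / 2) * (\<integral>\<^sup>+y. ?P x y \<partial>?N) \<partial>?N)"
      by (intro nn_integral_cong nn_integral_cmult inner)
    also have "\<dots> = ennreal (sqrt 3 / 2) * (\<integral>\<^sup>+x. \<integral>\<^sup>+y. ?P x y \<partial>?N \<partial>?N)"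
      by (rule nn_integral_cmult[OF outer])
    finally show ?thesis .
  qed
  also have "\<dots> \<le> ennreal (sqrt 3 / 2) * ennreal ((sqrt 3 / 2) ^ card I *
      (integral\<^sup>L ?N (?F f) * integral\<^sup>L ?N (?F g) * integral\<^sup>L ?N (?F h)) powr (2/3))"
    by (rule mult_left_mono[OF insert(3)[OF box_supported_fiber_integral(1)[OF insert(1,2) f]
          box_supported_fiber_integral(1)[OF insert(1,2) g] box_supported_fiber_integral(1)[OF insert(1,2) h]]]) simp
  also have "\<dots> = ennreal ((sqrt 3 / 2) ^ card (insert i I) * (integral\<^sup>L ?N' f * integral\<^sup>L ?N' g * integral\<^sup>L ?N' h) powr (2/3))"
    using insert(1,2) f g h by (simp add: box_supported_fiber_integral(2) ennreal_mult'[symmetric] mult.assoc)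
  finally show ?case .
qed

text \<open>Each coordinate contributes one Jacobian factor \<open>c\<close> by affine substitution
  on the line. It serves twice: for the volume of a dilated body and for replacing y by cy in the
  pair integral.\<close>

lemma nn_integral_lebesgue_PiM_scale:
  assumes "finite I" "0 < c" "f \<in> borel_measurable (lebesgue_PiM I)"
  shows "(\<integral>\<^sup>+x. f x \<partial>lebesgue_PiM I) = ennreal (c ^ card I) * (\<integral>\<^sup>+x. f (\<lambda>i\<in>I. c * x i) \<partial>lebesgue_PiM I)"
  using assms
proof (induction I arbitrary: f)
  case empty
  show ?case
    by (simp add: PiM_empty nn_integral_count_space_finite restrict_def)
next
  case (insert i I)
  let ?N = "lebesgue_PiM I" and ?N' = "lebesgue_PiM (insert i I)"
  note f [measurable] = insert(5)
  interpret N: sigma_finite_measure ?N using insert by (intro lborel_PiM.sigma_finite)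
  have upd: "(\<lambda>(x, t). x(i := t)) \<in> measurable (?N \<Otimes>\<^sub>M lborel) ?N'" by (rule measurable_add_dim)
  have fm: "(\<lambda>(x, t). f (x(i := t))) \<in> borel_measurable (?N \<Otimes>\<^sub>M lborel)"
    using measurable_compose[OF upd f] by (simp add: split_beta')
  have sc [measurable]: "(\<lambda>x. \<lambda>i\<in>J. c * x i) \<in> measurable (lebesgue_PiM J) (lebesgue_PiM J)" for J :: "'a set"
    by (intro measurable_restrict) simp
  have Fm: "(\<lambda>x. \<integral>\<^sup>+t. f (x(i := t)) \<partial>lborel) \<in> borel_measurable ?N"
    using fm by (rule lborel.borel_measurable_nn_integral)
  have fib: "(\<lambda>t. f (x(i := t))) \<in> borel_measurable borel" if "x \<in> space ?N" for x
    using measurable_Pair2[OF fm that] by simp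
  have "(\<integral>\<^sup>+x. f x \<partial>?N') = (\<integral>\<^sup>+x. \<integral>\<^sup>+t. f (x(i := t)) \<partial>lborel \<partial>?N)"
    by (rule lborel_PiM.product_nn_integral_insert[OF insert(1,2) f])
  also have "\<dots> = ennreal (c ^ card I) * (\<integral>\<^sup>+x. \<integral>\<^sup>+t. f ((\<lambda>i\<in>I. c * x i)(i := t)) \<partial>lborel \<partial>?N)"
    by (rule insert(3)[OF insert(4) Fm])
  also have "(\<integral>\<^sup>+x. \<integral>\<^sup>+t. f ((\<lambda>i\<in>I. c * x i)(i := t)) \<partial>lborel \<partial>?N)
      = (\<integral>\<^sup>+x. ennreal c * (\<integral>\<^sup>+t. f ((\<lambda>i\<in>I. c * x i)(i := c * t)) \<partial>lborel) \<partial>?N)"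
  proof (rule nn_integral_cong)
    fix x assume "x \<in> space ?N"
    then have "(\<lambda>i\<in>I. c * x i) \<in> space ?N" by (auto simp: space_PiM)
    from nn_integral_real_affine[OF fib[OF this], of c 0]
    show "(\<integral>\<^sup>+t. f ((\<lambda>i\<in>I. c * x i)(i := t)) \<partial>lborel) = ennreal c * (\<integral>\<^sup>+t. f ((\<lambda>i\<in>I. c * x i)(i := c * t)) \<partial>lborel)"
      using insert(4) by simp
  qed
  also have "\<dots> = (\<integral>\<^sup>+x. ennreal c * (\<integral>\<^sup>+t. f (\<lambda>j\<in>insert i I. c * (x(i := t)) j) \<partial>lborel) \<partial>?N)"
  proof -
    have "(\<lambda>i\<in>I. c * x i)(i := c * t) = (\<lambda>j\<in>insert i I. c * (x(i := t)) j)" for x t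
      using insert(2) by (auto simp: fun_eq_iff restrict_def)
    then show ?thesis by simp
  qed
  also have "\<dots> = ennreal c * (\<integral>\<^sup>+x. \<integral>\<^sup>+t. f (\<lambda>j\<in>insert i I. c * (x(i := t)) j) \<partial>lborel \<partial>?N)"
  proof (rule nn_integral_cmult, rule lborel.borel_measurable_nn_integral)
    show "(\<lambda>(x, t). f (\<lambda>j\<in>insert i I. c * (x(i := t)) j)) \<in> borel_measurable (?N \<Otimes>\<^sub>M lborel)"
      using measurable_compose[OF upd measurable_compose[OF sc f]] by (simp only: split_beta')
  qed
  also have "(\<integral>\<^sup>+x. \<integral>\<^sup>+t. f (\<lambda>j\<in>insert i I. c * (x(i := t)) j) \<partial>lborel \<partial>?N) = (\<integral>\<^sup>+x. f (\<lambda>j\<in>insert i I. c * x j) \<partial>?N')"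
    by (rule lborel_PiM.product_nn_integral_insert[OF insert(1,2) measurable_compose[OF sc f], symmetric])
  finally have "(\<integral>\<^sup>+x. f x \<partial>?N') = ennreal (c ^ card I) * (ennreal c * (\<integral>\<^sup>+x. f (\<lambda>j\<in>insert i I. c * x j) \<partial>?N'))" .
  moreover have "ennreal (c ^ card (insert i I)) = ennreal (c ^ card I) * ennreal c"
    using insert(1,2,4) by (simp add: ennreal_mult'[symmetric] mult.commute)
  ultimately show ?case by (simp only: mult.assoc)
qed

section \<open>Greedy choice of independent points\<close>

text \<open>The average measure of a neighbourhood is at most \<open>D / a\<close>. By Markov's
  inequality, points whose neighbourhood has at least twice that measure fill at most half of
  \<open>A\<close> and are thrown away. Then \<open>k\<close> chosen points block at most
  \<open>k * (2 * D / a)\<close>, and a further point exists as long as this is below the remaining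
  \<open>a / 2\<close>, which is the condition on \<open>k\<close>.\<close>

lemma independent_points:
  fixes M :: "'a measure" and r :: "'a \<Rightarrow> 'a \<Rightarrow> bool"
  assumes A: "A \<in> sets M" "emeasure M A = ennreal a" "0 < a" and D: "0 < D"
    and nbh: "\<And>x. x \<in> A \<Longrightarrow> {y\<in>A. r x y} \<in> sets M"
    and deg: "(\<lambda>x. emeasure M {y\<in>A. r x y}) \<in> borel_measurable M"
    and le: "(\<integral>\<^sup>+x. emeasure M {y\<in>A. r x y} * indicator A x \<partial>M) \<le> ennreal D"
    and refl: "\<And>x. x \<in> A \<Longrightarrow> r x x" and sym: "\<And>x y. r x y \<Longrightarrow> r y x"
    and small: "\<And>k. k < m \<Longrightarrow> 4 * real k * D < a\<^sup>2"
  obtains X where "finite X" "X \<subseteq> A" "card X = m" "\<And>x y. x \<in> X \<Longrightarrow> y \<in> X \<Longrightarrow> x \<noteq> y \<Longrightarrow> \<not> r x y"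
proof -
  let ?N = "\<lambda>x. {y\<in>A. r x y}"
  define A' where "A' = {x\<in>A. emeasure M (?N x) < ennreal (2 * D / a)}"
  have bad: "emeasure M (A - A') \<le> ennreal (a / 2)"
  proof -
    have "A - A' \<subseteq> {x\<in>A. 1 \<le> ennreal (a / (2 * D)) * emeasure M (?N x)}"
    proof
      fix x assume "x \<in> A - A'"
      then have "x \<in> A" "ennreal (2 * D / a) \<le> emeasure M (?N x)" by (auto simp: A'_def)
      moreover from this(2) have "ennreal (a / (2 * D)) * ennreal (2 * D / a) \<le> ennreal (a / (2 * D)) * emeasure M (?N x)"
        by (rule mult_left_mono) simp
      moreover have "ennreal (a / (2 * D)) * ennreal (2 * D / a) = 1"
        using A(3) D by (simp add: ennreal_mult'[symmetric])
      ultimately show "x \<in> {x\<in>A. 1 \<le> ennreal (a / (2 * D)) * emeasure M (?N x)}" by simp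
    qed
    then have "emeasure M (A - A') \<le> emeasure M {x\<in>A. 1 \<le> ennreal (a / (2 * D)) * emeasure M (?N x)}"
      using A(1) deg by (intro emeasure_mono) measurable
    also have "\<dots> \<le> ennreal (a / (2 * D)) * (\<integral>\<^sup>+x. emeasure M (?N x) * indicator A x \<partial>M)"
      by (intro nn_integral_Markov_inequality borel_measurable_times_ennreal borel_measurable_indicator deg A(1))
    also have "\<dots> \<le> ennreal (a / (2 * D)) * ennreal D"
      by (rule mult_left_mono[OF le]) simp
    also have "\<dots> = ennreal (a / 2)"
      using A(3) D by (simp add: ennreal_mult'[symmetric])
    finally show ?thesis .
  qed
  have "\<exists>X. finite X \<and> X \<subseteq> A' \<and> card X = k \<and> (\<forall>x\<in>X. \<forall>y\<in>X. x \<noteq> y \<longrightarrow> \<not> r x y)" if "k \<le> m" for k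
    using that
  proof (induction k)
    case 0
    then show ?case by (intro exI[of _ "{}"]) simp
  next
    case (Suc k)
    then obtain X where X: "finite X" "X \<subseteq> A'" "card X = k" "\<forall>x\<in>X. \<forall>y\<in>X. x \<noteq> y \<longrightarrow> \<not> r x y" by auto
    have XA: "X \<subseteq> A" using X(2) by (auto simp: A'_def)
    have "\<not> A' \<subseteq> (\<Union>x\<in>X. ?N x)"
    proof
      assume sub: "A' \<subseteq> (\<Union>x\<in>X. ?N x)"
      have U: "(\<Union>x\<in>X. ?N x) \<in> sets M" using X(1) XA nbh by (intro sets.finite_UN) auto
      have A'': "A - A' \<in> sets M"
      proof -
        have "A' = A \<inter> {x\<in>space M. emeasure M (?N x) < ennreal (2 * D / a)}"
          using sets.sets_into_space[OF A(1)] by (auto simp: A'_def)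
        moreover have "{x\<in>space M. emeasure M (?N x) < ennreal (2 * D / a)} \<in> sets M"
          using deg by measurable
        ultimately show ?thesis using A(1) by auto
      qed
      have "ennreal a = emeasure M A" using A by simp
      also have "\<dots> \<le> emeasure M ((\<Union>x\<in>X. ?N x) \<union> (A - A'))"
        using sub U A'' by (intro emeasure_mono) auto
      also have "\<dots> \<le> emeasure M (\<Union>x\<in>X. ?N x) + emeasure M (A - A')"
        by (rule emeasure_subadditive[OF U A''])
      also have "\<dots> \<le> (\<Sum>x\<in>X. emeasure M (?N x)) + ennreal (a / 2)"
        using X(1) XA nbh by (intro add_mono bad emeasure_subadditive_finite) auto
      also have "\<dots> \<le> (\<Sum>x\<in>X. ennreal (2 * D / a)) + ennreal (a / 2)"
        using X(2) by (intro add_right_mono sum_mono) (auto simp: A'_def intro: less_imp_le)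
      also have "\<dots> = ennreal (real k * (2 * D / a) + a / 2)"
        using X(3) A(3) D by (simp add: ennreal_mult'[symmetric] ennreal_of_nat_eq_real_of_nat)
      finally have "a \<le> real k * (2 * D / a) + a / 2"
        using A(3) D by (subst (asm) ennreal_le_iff) auto
      then have "a * a \<le> 4 * real k * D" using A(3) by (simp add: field_simps)
      then show False using small[of k] Suc.prems by (simp add: power2_eq_square)
    qed
    then obtain z where z: "z \<in> A'" "\<And>x. x \<in> X \<Longrightarrow> \<not> r x z" by (auto simp: A'_def)
    \<comment> \<open>Reflexivity is what forces the new point to differ from those already chosen,
      so that the cardinality grows.\<close>
    have "z \<notin> X" using z refl XA by auto
    moreover have "\<not> r z x" if "x \<in> X" for x using z(2)[OF that] sym by blast
    ultimately show ?case
      using X z by (intro exI[of _ "insert z X"]) auto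
  qed
  from this[of m] that show ?thesis by (auto simp: A'_def)
qed

section \<open>Convex bodies containing the origin in the interior\<close>

lemma continuous_on_smul: "continuous_on S (\<lambda>t::real. vadd p (smul t x))"
  unfolding vadd_def smul_def by (intro continuous_on_coordinatewise_then_product continuous_intros)

lemma Rd_closed_ops: "x \<in> Rd d \<Longrightarrow> y \<in> Rd d \<Longrightarrow> vsub x y \<in> Rd d" "x \<in> Rd d \<Longrightarrow> smul c x \<in> Rd d"
  "x \<in> Rd d \<Longrightarrow> y \<in> Rd d \<Longrightarrow> vadd x y \<in> Rd d"
  by (auto simp: Rd_def vsub_def smul_def vadd_def)

text \<open>Restriction to a line reduces the topology to one dimension: the line is continuous into
  the product topology, so the preimage of an open set around \<open>p\<close> contains an interval
  around 0.\<close>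

lemma rint_directions:
  assumes "p \<in> rint d K" "p \<in> Rd d" "x \<in> Rd d"
  obtains e where "0 < e" "\<And>t. \<bar>t\<bar> < e \<Longrightarrow> vadd p (smul t x) \<in> K"
proof -
  obtain U where U: "openin (top_of_set (Rd d)) U" "p \<in> U" "U \<subseteq> K"
    using assms(1) by (auto simp: rint_def interior_of_def)
  then obtain T where T: "open T" "U = Rd d \<inter> T" by (auto simp: openin_open)
  have "open ((\<lambda>t::real. vadd p (smul t x)) -` T)"
    using T(1) continuous_on_smul by (rule open_vimage)
  moreover have "0 \<in> (\<lambda>t::real. vadd p (smul t x)) -` T"
    using U(2) T(2) by (simp add: vadd_def smul_def)
  ultimately obtain e where "0 < e" "ball 0 e \<subseteq> (\<lambda>t::real. vadd p (smul t x)) -` T"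
    by (meson openE)
  then have "vadd p (smul t x) \<in> K" if "\<bar>t\<bar> < e" for t
    using that assms(2,3) U(3) T(2) Rd_closed_ops by (auto simp: subset_eq dist_real_def)
  then show ?thesis using that \<open>0 < e\<close> by blast
qed

lemma mem_bd_if_not_mem_rint: "x \<in> K \<Longrightarrow> K \<subseteq> Rd d \<Longrightarrow> x \<notin> rint d K \<Longrightarrow> x \<in> bd d K"
  unfolding bd_def rint_def frontier_of_def
  using closure_of_subset[of K "top_of_set (Rd d)"] by auto

locale origin_body =
  fixes d :: nat and K :: "(nat \<Rightarrow> real) set"
  assumes body: "convex_body d K" and origin: "(\<lambda>_. 0) \<in> rint d K"
begin

lemma subset_Rd: "K \<subseteq> Rd d" and compact: "compact K" and closed: "closed K"
  using body by (auto simp: convex_body_def intro: compact_imp_closed)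

lemma zero_mem: "(\<lambda>_. 0) \<in> K"
  using origin interior_of_subset by (fastforce simp: rint_def)

text \<open>The coefficients may sum to less than 1 because the origin belongs to \<open>K\<close>:
  normalize them, then shrink the resulting point by the factor \<open>a + b\<close>.\<close>

lemma convex_comb:
  assumes "x \<in> K" "y \<in> K" "0 \<le> a" "0 \<le> b" "a + b \<le> 1"
  shows "vadd (smul a x) (smul b y) \<in> K"
proof -
  have cv: "vadd (smul (1 - u) x) (smul u y) \<in> K" if "x \<in> K" "y \<in> K" "0 \<le> u" "u \<le> 1" for x y u
    using body that by (auto simp: convex_body_def)
  show ?thesis
  proof (cases "a + b = 0")
    case True
    then have "a = 0" "b = 0" using assms by auto
    then show ?thesis using zero_mem by (simp add: vadd_def smul_def)
  next
    case False
    have "vadd (smul (1 - b / (a + b)) x) (smul (b / (a + b)) y) \<in> K"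
      using assms False by (intro cv) (auto simp: field_simps)
    from cv[OF zero_mem this, of "a + b"]
    have "vadd (smul (1 - (a + b)) (\<lambda>_. 0)) (smul (a + b) (vadd (smul (1 - b / (a + b)) x) (smul (b / (a + b)) y))) \<in> K"
      using assms by simp
    also have "vadd (smul (1 - (a + b)) (\<lambda>_. 0)) (smul (a + b) (vadd (smul (1 - b / (a + b)) x) (smul (b / (a + b)) y)))
       = vadd (smul a x) (smul b y)"
    proof -
      have "(a + b) * (1 - b / (a + b)) = a" "(a + b) * (b / (a + b)) = b"
        using False by (simp_all add: right_diff_distrib)
      then show ?thesis
        unfolding vadd_def smul_def by (simp only: distrib_left mult.assoc[symmetric]) simp
    qed
    finally show ?thesis .
  qed
qed

lemma smul_mem: "x \<in> K \<Longrightarrow> 0 \<le> a \<Longrightarrow> a \<le> 1 \<Longrightarrow> smul a x \<in> K"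
  using convex_comb[of x "\<lambda>_. 0" a 0] zero_mem by (simp add: vadd_def smul_def)

lemma absorbing:
  assumes "x \<in> Rd d"
  obtains e where "0 < e" "\<And>t. \<bar>t\<bar> < e \<Longrightarrow> smul t x \<in> K"
  using rint_directions[OF origin _ assms] by (auto simp: Rd_def vadd_def smul_def)

text \<open>Strictness comes from closedness: along the ray through \<open>v\<close> a whole
  neighbourhood of \<open>v\<close> misses \<open>K\<close>, which keeps all admissible factors away
  from 1.\<close>

lemma normK_gt_1:
  assumes v: "v \<in> Rd d" "v \<notin> K"
  shows "1 < normK K v"
proof -
  let ?S = "{l. l > 0 \<and> v \<in> (\<lambda>y. smul l y) ` K}"
  have S: "smul (1 / l) v \<in> K \<and> 0 < l" if "l \<in> ?S" for l
    using that by (auto simp: smul_def)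
  have "open ((\<lambda>t::real. vadd (\<lambda>_. 0) (smul t v)) -` (- K))"
    by (intro open_vimage continuous_on_smul open_Compl closed)
  moreover have "1 \<in> (\<lambda>t::real. vadd (\<lambda>_. 0) (smul t v)) -` (- K)"
    using v by (simp add: vadd_def smul_def)
  ultimately obtain e where e: "0 < e" "ball 1 e \<subseteq> (\<lambda>t::real. vadd (\<lambda>_. 0) (smul t v)) -` (- K)"
    by (meson openE)
  define \<eta> where "\<eta> = min e (1 / 2)"
  have \<eta>: "0 < \<eta>" "\<eta> < 1" "smul t v \<notin> K" if "\<bar>t - 1\<bar> < \<eta>" for t
    using e that by (auto simp: \<eta>_def subset_eq dist_real_def vadd_def smul_def abs_minus_commute)
  have \<eta>01: "0 < \<eta>" "\<eta> < 1" using e by (auto simp: \<eta>_def)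
  have lower: "1 / (1 - \<eta>) \<le> l" if "l \<in> ?S" for l
  proof -
    have "1 < l"
    proof (rule ccontr)
      assume "\<not> 1 < l"
      then have "smul l (smul (1 / l) v) \<in> K"
        using S[OF that] smul_mem[of "smul (1 / l) v" l] by simp
      then show False using v S[OF that] by (simp add: smul_def)
    qed
    moreover have "\<not> \<bar>1 / l - 1\<bar> < \<eta>" using \<eta>(3) S[OF that] by blast
    ultimately have "1 / l \<le> 1 - \<eta>" by (simp add: abs_if)
    then show ?thesis using \<open>1 < l\<close> \<eta>01 by (simp add: field_simps)
  qed
  \<comment> \<open>The set of admissible factors must be shown nonempty, since the real infimum of
    the empty set carries no information. The origin being interior supplies such a factor.\<close>
  obtain f where f: "0 < f" "\<And>t. \<bar>t\<bar> < f \<Longrightarrow> smul t v \<in> K" using absorbing[OF v(1)] by blast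
  then have "smul (f / 2) v \<in> K" by simp
  moreover have "v = smul (2 / f) (smul (f / 2) v)" using f(1) by (simp add: smul_def)
  ultimately have "v \<in> smul (2 / f) ` K"
    using imageI[of "smul (f / 2) v" K "smul (2 / f)"] by metis
  then have "2 / f \<in> ?S" using f(1) by simp
  then have "?S \<noteq> {}" by blast
  then have "1 / (1 - \<eta>) \<le> Inf ?S" using lower by (rule cInf_greatest)
  moreover have "1 < 1 / (1 - \<eta>)" using \<eta>01 by simp
  ultimately show ?thesis by (simp add: normK_def)
qed

text \<open>The largest \<open>t\<close> with \<open>t * x\<close> in \<open>K\<close> is attained
  because \<open>K\<close> is closed. It stays below \<open>1 / c\<close>, since otherwise shrinking
  \<open>t * x\<close> would put \<open>x / c\<close> into \<open>K\<close>. At an interior point it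
  could still be increased, so the point lies on the boundary.\<close>

lemma radial_projection:
  assumes "x \<in> K" "0 < c" "smul (1 / c) x \<notin> K"
  obtains t where "1 \<le> t" "t < 1 / c" "smul t x \<in> K" "smul t x \<in> bd d K"
proof -
  let ?T = "{t. smul t x \<in> K}"
  have T: "closed ?T"
    using closed_vimage[OF closed continuous_on_smul[of UNIV "\<lambda>_. 0" x]]
    by (simp add: vimage_def vadd_def smul_def)
  have ub: "t < 1 / c" if "t \<in> ?T" for t
  proof (rule ccontr)
    assume "\<not> t < 1 / c"
    then have "1 / c \<le> t" by simp
    moreover have "0 < 1 / c" using assms by simp
    ultimately have "0 < t" by (rule less_le_trans[rotated])
    have "smul ((1 / c) / t) (smul t x) \<in> K"
    proof (rule smul_mem)
      show "0 \<le> (1 / c) / t" using \<open>0 < t\<close> \<open>0 < c\<close> by simp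
      show "(1 / c) / t \<le> 1" using \<open>0 < t\<close> \<open>1 / c \<le> t\<close> by (subst divide_le_eq_1_pos)
    qed (use that in simp)
    moreover have "smul ((1 / c) / t) (smul t x) = smul (1 / c) x"
      using \<open>0 < t\<close> by (simp add: smul_def)
    ultimately show False using assms by simp
  qed
  have one: "1 \<in> ?T" using assms by (simp add: smul_def)
  have bdd: "bdd_above ?T" using ub by (meson bdd_above.I less_imp_le)
  define t where "t = Sup ?T"
  have t: "t \<in> ?T" unfolding t_def using one by (intro closed_contains_Sup bdd T) auto
  have t1: "1 \<le> t" unfolding t_def by (rule cSup_upper[OF one bdd])
  have "smul t x \<notin> rint d K"
  proof
    assume r: "smul t x \<in> rint d K"
    have "smul t x \<in> Rd d" using t subset_Rd by auto
    then obtain e where e: "0 < e" "\<And>s. \<bar>s\<bar> < e \<Longrightarrow> vadd (smul t x) (smul s (smul t x)) \<in> K"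
      using rint_directions[OF r] by blast
    have "vadd (smul t x) (smul (e / 2) (smul t x)) = smul (t * (1 + e / 2)) x"
      by (simp add: vadd_def smul_def fun_eq_iff algebra_simps)
    then have "t * (1 + e / 2) \<in> ?T" using e(2)[of "e / 2"] e(1) by simp
    then have "t * (1 + e / 2) \<le> t" unfolding t_def by (rule cSup_upper[OF _ bdd])
    moreover have "t * 1 < t * (1 + e / 2)" using t1 e(1) by (intro mult_strict_left_mono) auto
    ultimately show False by simp
  qed
  then have "smul t x \<in> bd d K" using t subset_Rd by (intro mem_bd_if_not_mem_rint) auto
  then show ?thesis using that t t1 ub[OF t] by blast
qed

text \<open>The coefficient \<open>1 / t - c / s\<close> is nonnegative because
  \<open>c / s \<le> c < 1 / t\<close>, and the two coefficients add up to \<open>1 / t\<close>,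
  which is at most 1. The bound \<open>t < 1 / c\<close>, available only for points of the shell, is
  what makes this work.\<close>

lemma vsub_smul_mem:
  assumes "1 \<le> t" "t < 1 / c" "1 \<le> s" "0 < c"
    and "smul t x \<in> K" "vsub (smul t x) (smul s y) \<in> K"
  shows "vsub x (smul c y) \<in> K"
proof -
  have "c / s \<le> c / 1" using assms by (intro divide_left_mono) auto
  also have "\<dots> \<le> 1 / t" using assms by (simp add: field_simps)
  finally have le: "c / s \<le> 1 / t" .
  have "vadd (smul (c / s) (vsub (smul t x) (smul s y))) (smul (1 / t - c / s) (smul t x)) \<in> K"
    using assms le by (intro convex_comb) auto
  also have "vadd (smul (c / s) (vsub (smul t x) (smul s y))) (smul (1 / t - c / s) (smul t x)) = vsub x (smul c y)"
    using assms by (simp add: vadd_def vsub_def smul_def fun_eq_iff field_simps)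
  finally show ?thesis .
qed

lemma h'_le_kappa': "h' d K \<le> kappa' d K"
  unfolding h'_def kappa'_def
proof (rule SUP_mono)
  fix P assume "P \<in> {P. finite P \<and> P \<subseteq> bd d K \<and> (\<forall>p\<in>P. \<forall>q\<in>P. p \<noteq> q \<longrightarrow> normK K (vsub p q) > 1)}"
  then have P: "finite P" "P \<subseteq> bd d K" "\<And>p q. p \<in> P \<Longrightarrow> q \<in> P \<Longrightarrow> p \<noteq> q \<Longrightarrow> normK K (vsub p q) > 1"
    by auto
  have PK: "P \<subseteq> K"
  proof -
    have "closedin (top_of_set (Rd d)) K" using closed subset_Rd by (simp add: closed_subset)
    then show ?thesis using P(2) by (auto simp: bd_def frontier_of_def closure_of_closedin)
  qed
  have nK: "normK K v \<le> 1" if "v \<in> K" for v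
    unfolding normK_def using that
    by (intro cInf_lower) (auto intro!: bdd_belowI[of _ 0] image_eqI[of _ _ v] simp: smul_def)
  let ?a = "\<lambda>p. (smul (- 1) p, 1 :: real)"
  have inj: "inj_on ?a P" by (auto simp: inj_on_def smul_def fun_eq_iff)
  have hom: "homothet K (?a p) = (\<lambda>y. vsub y p) ` K" for p
    by (simp add: homothet_def vadd_def smul_def vsub_def)
  have "pi_strict_minkowski d K (?a ` P)"
    unfolding pi_strict_minkowski_def
  proof (intro conjI ballI impI)
    fix a b assume a: "a \<in> ?a ` P" and b: "b \<in> ?a ` P"
    show "fst a \<in> Rd d" "0 < snd a"
      using a PK subset_Rd Rd_closed_ops(2) by auto
    obtain p q where pq: "p \<in> P" "q \<in> P" "a = ?a p" "b = ?a q" using a b by auto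
    have zero: "(\<lambda>_. 0) \<in> homothet K (?a r)" if "r \<in> P" for r
      unfolding hom using that PK by (intro image_eqI[of _ _ r]) (auto simp: vsub_def)
    show "homothet K a \<inter> homothet K b \<noteq> {}" using zero pq by blast
    assume "a \<noteq> b"
    then have "p \<noteq> q" using pq by auto
    show "fst a \<notin> homothet K b"
    proof
      assume "fst a \<in> homothet K b"
      then obtain y where "y \<in> K" "smul (- 1) p = vsub y q" unfolding pq hom by auto
      \<comment> \<open>The centre -p lies in K - q exactly when q - p lies in K. As the norm need
        not be symmetric, the separation hypothesis has to be used for the pair in this
        order.\<close>
      moreover from this(2) have "y = vsub q p"
        by (auto simp: smul_def vsub_def fun_eq_iff algebra_simps)
      ultimately have "normK K (vsub q p) \<le> 1" using nK by simp
      then show False using P(3)[of q p] pq \<open>p \<noteq> q\<close> by simp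
    qed
  qed
  then show "\<exists>F\<in>{F. finite F \<and> pi_strict_minkowski d K F}. enat (card P) \<le> enat (card F)"
    using P(1) inj by (intro bexI[of _ "?a ` P"]) (auto simp: card_image)
qed

end

section \<open>Volumes\<close>

text \<open>
  Lebesgue measure on R^d is the product measure on functions that are undefined outside {..<d};
  padding with zeros identifies them with the vectors of Rd d.
\<close>
definition pad :: "nat \<Rightarrow> (nat \<Rightarrow> real) \<Rightarrow> nat \<Rightarrow> real" where
  "pad d x = (\<lambda>i. if i < d then x i else 0)"

lemma pad_Rd: "pad d x \<in> Rd d"
  by (simp add: pad_def Rd_def)

lemma pad_diff: "pad d (\<lambda>i\<in>{..<d}. x i - y i) = vsub (pad d x) (pad d y)"
  by (auto simp: pad_def vsub_def)

lemma pad_scale: "pad d (\<lambda>i\<in>{..<d}. c * x i) = smul c (pad d x)"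
  by (auto simp: pad_def smul_def)

lemma measurable_pad: "pad d \<in> measurable (lebesgue_PiM {..<d}) borel"
proof (rule measurable_coordinatewise_then_product)
  show "(\<lambda>x. pad d x i) \<in> borel_measurable (lebesgue_PiM {..<d})" for i
    by (cases "i < d") (simp_all add: pad_def)
qed

context origin_body
begin

abbreviation M :: "(nat \<Rightarrow> real) measure" where "M \<equiv> lebesgue_PiM {..<d}"

text \<open>The body tK, read in the coordinates of M.\<close>
definition region :: "real \<Rightarrow> (nat \<Rightarrow> real) set" where
  "region t = {x \<in> space M. smul (1 / t) (pad d x) \<in> K}"

lemma region_sets: "region t \<in> sets M"
proof -
  have "continuous_on UNIV (smul (1 / t))"
    unfolding smul_def by (intro continuous_on_coordinatewise_then_product continuous_intros) auto
  then have "(\<lambda>x. smul (1 / t) (pad d x)) \<in> measurable M borel"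
    by (intro measurable_compose[OF measurable_pad] borel_measurable_continuous_onI)
  from measurable_sets[OF this borel_closed[OF closed]] show ?thesis
    by (simp add: region_def vimage_def Int_def conj_commute)
qed

lemma region_1: "region 1 = {x \<in> space M. pad d x \<in> K}"
  by (simp add: region_def smul_def)

lemma emeasure_region: "0 < t \<Longrightarrow> emeasure M (region t) = ennreal (t ^ d) * emeasure M (region 1)"
proof -
  assume t: "0 < t"
  have "emeasure M (region t) = (\<integral>\<^sup>+x. indicator (region t) x \<partial>M)"
    using region_sets by simp
  also have "\<dots> = ennreal (t ^ card {..<d}) * (\<integral>\<^sup>+x. indicator (region t) (\<lambda>i\<in>{..<d}. t * x i) \<partial>M)"
    using t region_sets by (intro nn_integral_lebesgue_PiM_scale) auto
  also have "(\<integral>\<^sup>+x. indicator (region t) (\<lambda>i\<in>{..<d}. t * x i) \<partial>M) = (\<integral>\<^sup>+x. indicator (region 1) x \<partial>M)"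
  proof (rule nn_integral_cong)
    fix x assume x: "x \<in> space M"
    moreover have "(\<lambda>i\<in>{..<d}. t * x i) \<in> space M" by (simp add: space_PiM)
    moreover have "smul (1 / t) (smul t (pad d x)) = pad d x" using t by (simp add: smul_def)
    ultimately show "indicator (region t) (\<lambda>i\<in>{..<d}. t * x i) = (indicator (region 1) x :: ennreal)"
      by (simp add: region_def pad_scale indicator_def) (simp add: smul_def)
  qed
  also have "\<dots> = emeasure M (region 1)" using region_sets by simp
  finally show ?thesis by simp
qed

lemma coordinates_bounded: obtains R where "\<And>x i. x \<in> K \<Longrightarrow> i < d \<Longrightarrow> \<bar>x i\<bar> \<le> R"
proof -
  have "\<exists>R. \<forall>x\<in>K. \<bar>x i\<bar> \<le> R" for i
  proof -
    have "continuous_on K (\<lambda>x. x i)" 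
      by (rule continuous_on_subset[OF continuous_on_product_coordinates subset_UNIV])
    then have "bounded ((\<lambda>x. x i) ` K)" using compact by (intro compact_imp_bounded compact_continuous_image)
    then show ?thesis by (auto simp: bounded_iff)
  qed
  then obtain R where R: "\<And>i x. x \<in> K \<Longrightarrow> \<bar>x i\<bar> \<le> R i" by metis
  show ?thesis
  proof (rule that[of "Max (R ` {..<d})"])
    fix x i assume "x \<in> K" "i < d"
    then have "\<bar>x i\<bar> \<le> R i" "R i \<le> Max (R ` {..<d})" using R by (auto intro!: Max_ge)
    then show "\<bar>x i\<bar> \<le> Max (R ` {..<d})" by simp
  qed
qed

text \<open>One \<open>R\<close> serves all \<open>t \<le> 1\<close> because tK is contained in K;
  the inequality requires a common cube for its three functions.\<close>

lemma region_box_supported: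
  obtains R where "\<And>t. 0 < t \<Longrightarrow> t \<le> 1 \<Longrightarrow> box_supported {..<d} 1 R (indicator (region t))"
proof -
  obtain R where R: "\<And>x i. x \<in> K \<Longrightarrow> i < d \<Longrightarrow> \<bar>x i\<bar> \<le> R" using coordinates_bounded by blast
  have "box_supported {..<d} 1 R (indicator (region t))" if t: "0 < t" "t \<le> 1" for t
    unfolding box_supported_def
  proof (intro conjI ballI impI)
    show "indicator (region t) \<in> borel_measurable M" using region_sets by simp
    show "0 \<le> (indicator (region t) x :: real)" "(indicator (region t) x :: real) \<le> 1" for x
      by (auto simp: indicator_def)
    fix x i assume i: "i \<in> {..<d}" "R < \<bar>x i\<bar>"
    have "x \<notin> region t"
    proof
      assume "x \<in> region t"
      then have "smul t (smul (1 / t) (pad d x)) \<in> K"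
        using t smul_mem[of "smul (1 / t) (pad d x)" t] by (simp add: region_def)
      then have "pad d x \<in> K" using t by (simp add: smul_def)
      then show False using R[of "pad d x" i] i by (simp add: pad_def)
    qed
    then show "indicator (region t) x = (0 :: real)" by simp
  qed
  then show ?thesis using that by blast
qed

definition vol :: real where "vol = measure M (region 1)"

lemma emeasure_region_vol: "0 < t \<Longrightarrow> emeasure M (region t) = ennreal (t ^ d * vol)"
proof -
  assume t: "0 < t"
  obtain R where "box_supported {..<d} 1 R (indicator (region 1))" 
    using region_box_supported by (metis zero_less_one order_refl)
  then have "integrable M (indicator (region 1) :: _ \<Rightarrow> real)" by (intro box_supported_integrable) auto
  then have "emeasure M (region 1) \<noteq> \<infinity>" using region_sets by (simp add: integrable_indicator_iff less_top)
  then show ?thesis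
    unfolding emeasure_region[OF t] vol_def using t by (simp add: emeasure_eq_ennreal_measure ennreal_mult)
qed

text \<open>Since the origin is interior, integer dilates of \<open>K\<close> exhaust the space, and
  their measures are multiples of \<open>vol\<close>. If \<open>vol\<close> were 0 the whole space
  would be null, yet it contains a unit cube of measure 1.\<close>

lemma vol_pos: "0 < vol"
proof (rule ccontr)
  assume "\<not> 0 < vol"
  then have "vol = 0" by (simp add: vol_def less_le)
  then have null: "region (Suc n) \<in> null_sets M" for n
    using region_sets by (simp add: null_sets_def emeasure_region_vol)
  have "space M \<subseteq> (\<Union>n. region (Suc n))"
  proof
    fix x assume x: "x \<in> space M"
    obtain e where e: "0 < e" "\<And>t. \<bar>t\<bar> < e \<Longrightarrow> smul t (pad d x) \<in> K" using absorbing[OF pad_Rd[where x = x]] by blast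
    obtain n where "inverse (real (Suc n)) < e" using reals_Archimedean[OF e(1)] by blast
    then have "x \<in> region (Suc n)" using x e(2)[of "1 / real (Suc n)"] by (simp add: region_def divide_inverse)
    then show "x \<in> (\<Union>n. region (Suc n))" by blast
  qed
  moreover have "(\<Union>n. region (Suc n)) \<in> null_sets M" using null by (intro null_sets_UN) 
  ultimately have "space M \<in> null_sets M" by (rule null_sets_subset[rotated 2]) simp
  moreover have "emeasure M (Pi\<^sub>E {..<d} (\<lambda>_. {0..1})) \<le> emeasure M (space M)"
    by (intro emeasure_mono) (auto simp: space_PiM)
  moreover have "emeasure M (Pi\<^sub>E {..<d} (\<lambda>_. {0..1})) = 1"
    by (subst lborel_PiM.emeasure_PiM) auto
  ultimately show False by (simp add: null_sets_def)
qed

text \<open>Indicators are unchanged by the power 2/3, so the left-hand side is a volume of pairs.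
  On the right, three volumes of order \<open>vol\<close> to the power 2/3 give
  \<open>vol\<^sup>2\<close>; estimating \<open>c ^ d\<close> by 1 loses only a constant once
  \<open>c ^ d = 1 / 2\<close>.\<close>

lemma difference_volume_le:
  assumes "0 < c" "c \<le> 1"
  shows "(\<integral>\<^sup>+x. \<integral>\<^sup>+y. indicator (region 1) x * indicator (region c) y *
      indicator (region 1) (\<lambda>i\<in>{..<d}. x i - y i) \<partial>M \<partial>M)
    \<le> ennreal ((sqrt 3 / 2) ^ d * vol\<^sup>2)"
proof -
  obtain R where R: "\<And>t. 0 < t \<Longrightarrow> t \<le> 1 \<Longrightarrow> box_supported {..<d} 1 R (indicator (region t))"
    using region_box_supported by blast
  have int: "integral\<^sup>L M (indicator (region t)) = t ^ d * vol" if "0 < t" for t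
    using emeasure_region_vol[OF that] region_sets vol_pos that by (simp add: measure_def)
  have ind: "ennreal ((indicator A x * indicator B y * indicator C z) powr (2/3)) = indicator A x * indicator B y * indicator C z"
    for A B C :: "(nat \<Rightarrow> real) set" and x y z by (simp add: indicator_def)
  have "(\<integral>\<^sup>+x. \<integral>\<^sup>+y. indicator (region 1) x * indicator (region c) y *
      indicator (region 1) (\<lambda>i\<in>{..<d}. x i - y i) \<partial>M \<partial>M)
    \<le> ennreal ((sqrt 3 / 2) ^ card {..<d} * (integral\<^sup>L M (indicator (region 1)) * integral\<^sup>L M (indicator (region c))
        * integral\<^sup>L M (indicator (region 1))) powr (2/3))"
    unfolding ind[symmetric] using assms by (intro brascamp_lieb_PiM[where B = 1 and R = R] R) auto
  also have "\<dots> \<le> ennreal ((sqrt 3 / 2) ^ d * vol\<^sup>2)"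
  proof (rule ennreal_leI)
    have "(integral\<^sup>L M (indicator (region 1)) * integral\<^sup>L M (indicator (region c))
        * integral\<^sup>L M (indicator (region 1))) powr (2/3) \<le> (vol ^ 3) powr (2/3)"
    proof (rule powr_mono2)
      have "c ^ d \<le> 1" using assms by (intro power_le_one) auto
      then have "vol * (c ^ d * vol) * vol \<le> vol * (1 * vol) * vol"
        using vol_pos by (intro mult_right_mono mult_left_mono) auto
      then show "integral\<^sup>L M (indicator (region 1)) * integral\<^sup>L M (indicator (region c))
        * integral\<^sup>L M (indicator (region 1)) \<le> vol ^ 3"
        by (simp only: int[OF zero_less_one] int[OF assms(1)] power_one mult_1_left power3_eq_cube)
    qed (use assms vol_pos in \<open>auto simp: int\<close>)
    also have "(vol ^ 3) powr (2/3) = vol\<^sup>2"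
      using vol_pos by (simp add: powr_powr flip: powr_numeral)
    finally show "(sqrt 3 / 2) ^ card {..<d} * (integral\<^sup>L M (indicator (region 1)) * integral\<^sup>L M (indicator (region c))
        * integral\<^sup>L M (indicator (region 1))) powr (2/3) \<le> (sqrt 3 / 2) ^ d * vol\<^sup>2"
      by (simp add: mult_left_mono)
  qed
  finally show ?thesis .
qed


section \<open>Close pairs in the shell and the resulting boundary points\<close>

lemma measurable_vsub_pad:
  "(\<lambda>p. vsub (pad d (fst p)) (smul c (pad d (snd p)))) \<in> measurable (M \<Otimes>\<^sub>M M) borel"
proof (rule measurable_coordinatewise_then_product)
  show "(\<lambda>p. vsub (pad d (fst p)) (smul c (pad d (snd p))) i) \<in> borel_measurable (M \<Otimes>\<^sub>M M)" for i
    by (cases "i < d") (simp_all add: vsub_def smul_def pad_def)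
qed

text \<open>Substituting cy for y turns x - cy with y in K into a plain difference with second point
  in cK. The Jacobian is \<open>c ^ d = 1 / 2\<close>, hence the factor 2.\<close>

lemma scaled_difference_volume_le:
  assumes "0 < c" "c \<le> 1" "c ^ d = 1 / 2"
  shows "(\<integral>\<^sup>+x. \<integral>\<^sup>+y. indicator (region 1) x * indicator (region 1) y *
      indicator K (vsub (pad d x) (smul c (pad d y))) \<partial>M \<partial>M)
    \<le> ennreal (2 * ((sqrt 3 / 2) ^ d * vol\<^sup>2))" (is "(\<integral>\<^sup>+x. \<integral>\<^sup>+y. ?g x y \<partial>M \<partial>M) \<le> _")
proof -
  interpret sigma_finite_measure M by (rule lborel_PiM.sigma_finite) simp
  let ?F = "\<lambda>x y. indicator (region 1) x * indicator (region c) y *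
      indicator (region 1) (\<lambda>i\<in>{..<d}. x i - y i) :: ennreal"
  note [measurable] = region_sets
  have diff: "(\<lambda>p. indicator (region 1) (\<lambda>i\<in>{..<d}. fst p i - snd p i) :: ennreal) \<in> borel_measurable (M \<Otimes>\<^sub>M M)"
    using measurable_compose[OF measurable_restrict_diff[of "{..<d}"], of "indicator (region 1) :: _ \<Rightarrow> ennreal" borel]
    by (simp add: split_beta')
  have Fm: "(\<lambda>(x, y). ?F x y) \<in> borel_measurable (M \<Otimes>\<^sub>M M)"
    unfolding split_beta' by (intro borel_measurable_times_ennreal diff) measurable
  have "(\<integral>\<^sup>+y. ?g x y \<partial>M) = 2 * (\<integral>\<^sup>+y. ?F x y \<partial>M)" if x: "x \<in> space M" for x
  proof -
    have "(\<integral>\<^sup>+y. ?F x y \<partial>M) = ennreal (c ^ card {..<d}) * (\<integral>\<^sup>+y. ?F x (\<lambda>i\<in>{..<d}. c * y i) \<partial>M)"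
      using measurable_Pair2[OF Fm x] assms(1) by (intro nn_integral_lebesgue_PiM_scale) simp_all
    also have "(\<integral>\<^sup>+y. ?F x (\<lambda>i\<in>{..<d}. c * y i) \<partial>M) = (\<integral>\<^sup>+y. ?g x y \<partial>M)"
    proof (rule nn_integral_cong)
      fix y assume y: "y \<in> space M"
      have sp: "(\<lambda>i\<in>{..<d}. u i) \<in> space M" for u :: "nat \<Rightarrow> real" by (simp add: space_PiM)
      have "smul (1 / c) (smul c (pad d y)) = pad d y" using assms(1) by (simp add: smul_def)
      moreover have "pad d (\<lambda>i. if i < d then c * y i else undefined) = smul c (pad d y)"
        by (auto simp: pad_def smul_def)
      ultimately show "?F x (\<lambda>i\<in>{..<d}. c * y i) = ?g x y"
        using y sp unfolding region_def[of c] region_1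
        by (simp add: pad_scale indicator_def pad_diff)
    qed
    also have "2 * (ennreal (c ^ card {..<d}) * (\<integral>\<^sup>+y. ?g x y \<partial>M)) = (\<integral>\<^sup>+y. ?g x y \<partial>M)"
    proof -
      have "2 * ennreal (1 / 2) = ennreal (2 * (1 / 2))" by (subst ennreal_mult) auto
      also have "\<dots> = 1" by simp
      finally have "2 * ennreal (c ^ card {..<d}) = 1" using assms(3) by (simp only: card_lessThan)
      then show ?thesis by (simp only: mult.assoc[symmetric] mult_1_left)
    qed
    finally show ?thesis by (rule sym)
  qed
  then have "(\<integral>\<^sup>+x. \<integral>\<^sup>+y. ?g x y \<partial>M \<partial>M) = (\<integral>\<^sup>+x. 2 * (\<integral>\<^sup>+y. ?F x y \<partial>M) \<partial>M)"
    by (rule nn_integral_cong)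
  also have "\<dots> = 2 * (\<integral>\<^sup>+x. \<integral>\<^sup>+y. ?F x y \<partial>M \<partial>M)"
    by (intro nn_integral_cmult borel_measurable_nn_integral Fm)
  also have "\<dots> \<le> 2 * ennreal ((sqrt 3 / 2) ^ d * vol\<^sup>2)"
    by (intro mult_left_mono difference_volume_le assms) simp
  also have "\<dots> = ennreal (2 * ((sqrt 3 / 2) ^ d * vol\<^sup>2))"
    by (simp add: ennreal_mult)
  finally show ?thesis .
qed

text \<open>The greedy choice is applied to the shell, of measure \<open>vol / 2\<close>, with
  \<open>4 * W\<close> as the bound for the measure of related pairs: \<open>2 * W\<close> for each
  of the two orders of a pair.\<close>

lemma separated_points:
  assumes c: "0 < c" "c < 1" "c ^ d = 1 / 2" and m: "\<And>k. k < m \<Longrightarrow> real k < (2 / sqrt 3) ^ d / 64"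
  obtains X where "finite X" "card X = m" "\<And>x. x \<in> X \<Longrightarrow> pad d x \<in> K \<and> smul (1 / c) (pad d x) \<notin> K"
    "\<And>x y. x \<in> X \<Longrightarrow> y \<in> X \<Longrightarrow> x \<noteq> y \<Longrightarrow> vsub (pad d x) (smul c (pad d y)) \<notin> K"
proof -
  interpret sigma_finite_measure M by (rule lborel_PiM.sigma_finite) simp
  interpret P: pair_sigma_finite M M by standard
  define A where "A = region 1 - region c"
  define W where "W = (sqrt 3 / 2) ^ d * vol\<^sup>2"
  define close where "close x y \<longleftrightarrow> vsub (pad d x) (smul c (pad d y)) \<in> K" for x y
  \<comment> \<open>Closeness is not symmetric, since \<open>c\<close> acts on one argument only and
    \<open>K\<close> may be asymmetric, while the greedy choice needs a symmetric relation.\<close>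
  define r where "r x y \<longleftrightarrow> close x y \<or> close y x" for x y
  define g :: "(nat \<Rightarrow> real) \<Rightarrow> (nat \<Rightarrow> real) \<Rightarrow> ennreal" where
    "g x y = indicator (region 1) x * indicator (region 1) y * indicator K (vsub (pad d x) (smul c (pad d y)))" for x y
  note [measurable] = region_sets
  have A [measurable]: "A \<in> sets M" unfolding A_def by measurable
  have sub: "region c \<subseteq> region 1"
  proof
    fix x assume x: "x \<in> region c"
    then have "smul c (smul (1 / c) (pad d x)) \<in> K"
      using c smul_mem[of "smul (1 / c) (pad d x)" c] by (simp add: region_def)
    then show "x \<in> region 1" using c x by (simp add: region_1 region_def) (simp add: smul_def)
  qed
  have eA: "emeasure M A = ennreal (vol / 2)"
    unfolding A_def using c vol_pos sub
    by (subst emeasure_Diff) (auto simp: emeasure_region_vol region_sets ennreal_minus)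
  have pairs: "{p \<in> space (M \<Otimes>\<^sub>M M). close (fst p) (snd p)} \<in> sets (M \<Otimes>\<^sub>M M)"
    using measurable_sets[OF measurable_vsub_pad borel_closed[OF closed], of c]
    by (simp add: close_def vimage_def Int_def conj_commute)
  then have [measurable]: "Measurable.pred (M \<Otimes>\<^sub>M M) (\<lambda>p. close (fst p) (snd p))" by (simp add: pred_def)
  have "Measurable.pred (M \<Otimes>\<^sub>M M) (\<lambda>p. close (snd p) (fst p))"
    using measurable_compose[OF measurable_pair_swap' [of M M] \<open>Measurable.pred (M \<Otimes>\<^sub>M M) (\<lambda>p. close (fst p) (snd p))\<close>]
    by (simp add: split_beta')
  then have [measurable]: "Measurable.pred (M \<Otimes>\<^sub>M M) (\<lambda>p. r (fst p) (snd p))"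
    unfolding r_def by measurable
  define Q where "Q = {p \<in> space (M \<Otimes>\<^sub>M M). snd p \<in> A \<and> r (fst p) (snd p)}"
  have Q: "Q \<in> sets (M \<Otimes>\<^sub>M M)" unfolding Q_def by measurable
  have fiber: "Pair x -` Q = {y \<in> A. r x y}" if "x \<in> space M" for x
    using that sets.sets_into_space[OF A] by (auto simp: Q_def space_pair_measure)
  have nbh: "{y \<in> A. r x y} \<in> sets M" if "x \<in> space M" for x
    using sets_Pair1[OF Q, of x] by (simp add: fiber[OF that])
  have deg: "(\<lambda>x. emeasure M {y \<in> A. r x y}) \<in> borel_measurable M"
    using measurable_emeasure_Pair[OF Q] by (rule measurable_cong[THEN iffD1, rotated]) (simp add: fiber)
  have gm: "(\<lambda>(x, y). g x y) \<in> borel_measurable (M \<Otimes>\<^sub>M M)"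
  proof -
    have "(\<lambda>p. indicator K (vsub (pad d (fst p)) (smul c (pad d (snd p)))) :: ennreal) \<in> borel_measurable (M \<Otimes>\<^sub>M M)"
      using closed by (intro measurable_compose[OF measurable_vsub_pad] borel_measurable_indicator borel_closed)
    then show ?thesis
      unfolding g_def split_beta' by (rule borel_measurable_times_ennreal[rotated]) measurable
  qed
  have gm': "(\<lambda>(x, y). g y x) \<in> borel_measurable (M \<Otimes>\<^sub>M M)"
    using measurable_compose[OF measurable_pair_swap'[of M M] gm] by (simp add: split_beta')
  have "(\<integral>\<^sup>+x. emeasure M {y \<in> A. r x y} * indicator A x \<partial>M) \<le> (\<integral>\<^sup>+x. (\<integral>\<^sup>+y. g x y \<partial>M) + (\<integral>\<^sup>+y. g y x \<partial>M) \<partial>M)"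
  proof (rule nn_integral_mono)
    fix x assume x: "x \<in> space M"
    show "emeasure M {y \<in> A. r x y} * indicator A x \<le> (\<integral>\<^sup>+y. g x y \<partial>M) + (\<integral>\<^sup>+y. g y x \<partial>M)"
    proof (cases "x \<in> A")
      case True
      then have "x \<in> region 1" by (simp add: A_def)
      have "emeasure M {y \<in> A. r x y} = (\<integral>\<^sup>+y. indicator {y \<in> A. r x y} y \<partial>M)" using nbh[OF x] by simp
      \<comment> \<open>Here the shell is enlarged to the whole body, for which the pair estimate is
        available; the two summands cover the two orders of a pair.\<close>
      also have "\<dots> \<le> (\<integral>\<^sup>+y. g x y + g y x \<partial>M)"
        using \<open>x \<in> region 1\<close> by (intro nn_integral_mono) (auto simp: g_def indicator_def r_def close_def A_def)
      also have "\<dots> = (\<integral>\<^sup>+y. g x y \<partial>M) + (\<integral>\<^sup>+y. g y x \<partial>M)"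
        using measurable_Pair2[OF gm x] measurable_Pair2[OF gm' x] by (intro nn_integral_add) simp_all
      finally show ?thesis using True by simp
    qed simp
  qed
  also have "\<dots> = (\<integral>\<^sup>+x. \<integral>\<^sup>+y. g x y \<partial>M \<partial>M) + (\<integral>\<^sup>+x. \<integral>\<^sup>+y. g y x \<partial>M \<partial>M)"
    by (intro nn_integral_add borel_measurable_nn_integral gm gm')
  also have "(\<integral>\<^sup>+x. \<integral>\<^sup>+y. g y x \<partial>M \<partial>M) = (\<integral>\<^sup>+x. \<integral>\<^sup>+y. g x y \<partial>M \<partial>M)"
    by (rule P.Fubini'[OF gm])
  also have "(\<integral>\<^sup>+x. \<integral>\<^sup>+y. g x y \<partial>M \<partial>M) + (\<integral>\<^sup>+x. \<integral>\<^sup>+y. g x y \<partial>M \<partial>M) \<le> ennreal (2 * W) + ennreal (2 * W)"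
    unfolding g_def W_def using c by (intro add_mono scaled_difference_volume_le) auto
  also have "\<dots> = ennreal (4 * W)" by (simp add: W_def flip: ennreal_plus)
  finally have le: "(\<integral>\<^sup>+x. emeasure M {y \<in> A. r x y} * indicator A x \<partial>M) \<le> ennreal (4 * W)" .
  have W: "0 < W" using vol_pos by (simp add: W_def)
  obtain X where X: "finite X" "X \<subseteq> A" "card X = m" "\<And>x y. x \<in> X \<Longrightarrow> y \<in> X \<Longrightarrow> x \<noteq> y \<Longrightarrow> \<not> r x y"
  proof (rule independent_points[OF A eA _ _ _ deg le])
    show "0 < vol / 2" "0 < 4 * W" using vol_pos W by auto
    show "{y \<in> A. r x y} \<in> sets M" if "x \<in> A" for x
      using that sets.sets_into_space[OF A] by (intro nbh) auto
    show "r x y \<Longrightarrow> r y x" for x y by (auto simp: r_def)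
    show "r x x" if "x \<in> A" for x
    proof -
      have "vsub (pad d x) (smul c (pad d x)) = smul (1 - c) (pad d x)"
        by (simp add: vsub_def smul_def fun_eq_iff algebra_simps)
      moreover have "pad d x \<in> K" using that by (simp add: A_def region_1)
      ultimately show ?thesis using smul_mem[of "pad d x" "1 - c"] c by (simp add: r_def close_def)
    qed
    \<comment> \<open>The origin of 64: \<open>16 * k * W < vol\<^sup>2 / 4\<close>, where
      \<open>W\<close> carries the factor \<open>(sqrt 3 / 2) ^ d\<close>.\<close>
    show "4 * real k * (4 * W) < (vol / 2)\<^sup>2" if "k < m" for k
    proof -
      have "real k * (sqrt 3 / 2) ^ d < (2 / sqrt 3) ^ d / 64 * (sqrt 3 / 2) ^ d"
        using m[OF that] by (intro mult_strict_right_mono) auto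
      also have "\<dots> = 1 / 64" by (simp add: power_mult_distrib[symmetric])
      finally have "real k * (sqrt 3 / 2) ^ d * (16 * vol\<^sup>2) < 1 / 64 * (16 * vol\<^sup>2)"
        using vol_pos by (intro mult_strict_right_mono) auto
      then show ?thesis by (simp add: W_def power_divide ac_simps)
    qed
  qed blast
  show ?thesis
  proof (rule that[OF X(1,3)])
    show "pad d x \<in> K \<and> smul (1 / c) (pad d x) \<notin> K" if "x \<in> X" for x
      using that X(2) unfolding A_def region_1 by (auto simp: region_def)
    show "vsub (pad d x) (smul c (pad d y)) \<notin> K" if "x \<in> X" "y \<in> X" "x \<noteq> y" for x y
      using X(4)[OF that] by (simp add: r_def close_def)
  qed
qed

lemma h'_lower_bound:
  assumes "0 < d" and m: "\<And>k. k < m \<Longrightarrow> real k < (2 / sqrt 3) ^ d / 64"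
  shows "enat m \<le> h' d K"
proof -
  \<comment> \<open>The value is the d-th root of 1/2, so that cK has half the volume of K.\<close>
  define c :: real where "c = (1 / 2) powr (1 / d)"
  have "0 < c" "c < 1"
    using assms(1) by (simp_all add: c_def powr_def ln_div)
  moreover have "c ^ d = 1 / 2"
    using assms(1) by (simp add: c_def powr_powr flip: powr_realpow)
  ultimately have c: "0 < c" "c < 1" "c ^ d = 1 / 2" .
  obtain X where X: "finite X" "card X = m" "\<And>x. x \<in> X \<Longrightarrow> pad d x \<in> K \<and> smul (1 / c) (pad d x) \<notin> K"
    "\<And>x y. x \<in> X \<Longrightarrow> y \<in> X \<Longrightarrow> x \<noteq> y \<Longrightarrow> vsub (pad d x) (smul c (pad d y)) \<notin> K"
    using separated_points[OF c m] by blast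
  have "\<exists>t. 1 \<le> t \<and> t < 1 / c \<and> smul t (pad d x) \<in> K \<and> smul t (pad d x) \<in> bd d K" if "x \<in> X" for x
    using radial_projection[of "pad d x" c] X(3)[OF that] c(1) by blast
  then obtain t where t: "\<And>x. x \<in> X \<Longrightarrow> 1 \<le> t x \<and> t x < 1 / c \<and> smul (t x) (pad d x) \<in> K \<and> smul (t x) (pad d x) \<in> bd d K"
    by metis
  define p where "p x = smul (t x) (pad d x)" for x
  have far: "vsub (p x) (p y) \<notin> K" if "x \<in> X" "y \<in> X" "x \<noteq> y" for x y
    using vsub_smul_mem[of "t x" c "t y" "pad d x" "pad d y"] t[OF that(1)] t[OF that(2)] X(4)[OF that] c(1)
    by (auto simp: p_def)
  \<comment> \<open>Coinciding projections would have difference 0, which lies in \<open>K\<close>,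
    contrary to \<open>far\<close>; so no point is lost in the projection.\<close>
  have "inj_on p X"
  proof (rule inj_onI, rule ccontr)
    fix x y assume "x \<in> X" "y \<in> X" "p x = p y" "x \<noteq> y"
    then show False using far[of x y] zero_mem by (simp add: vsub_def)
  qed
  then have card: "card (p ` X) = m" using X(2) by (simp add: card_image)
  have "p ` X \<in> {P. finite P \<and> P \<subseteq> bd d K \<and> (\<forall>p\<in>P. \<forall>q\<in>P. p \<noteq> q \<longrightarrow> normK K (vsub p q) > 1)}"
    using X(1) t far by (auto simp: p_def intro!: normK_gt_1 Rd_closed_ops pad_Rd)
  then show ?thesis
    unfolding h'_def card[symmetric] by (rule SUP_upper)
qed

end

theorem theorem6:
  shows "\<exists>d0::nat. \<forall>d\<ge>d0. \<forall>K. convex_body d K \<and> (\<lambda>_::nat. 0::real) \<in> rint d K \<longrightarrow>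
           h' d K \<le> kappa' d K \<and>
           ereal (1 / (4 * (real d)^2) * (2 / sqrt 3) ^ d) \<le> ereal_of_enat (h' d K)"
\<comment> \<open>The threshold 4 is where \<open>4 * d^2\<close> reaches 64, so that the required
  bound drops below the constant-factor bound already obtained.\<close>
proof (intro exI[of _ 4] allI impI conjI; elim conjE)
  fix d :: nat and K :: "(nat \<Rightarrow> real) set"
  assume d: "4 \<le> d" and "convex_body d K" "(\<lambda>_. 0) \<in> rint d K"
  then interpret origin_body d K by unfold_locales
  show "h' d K \<le> kappa' d K" by (rule h'_le_kappa')
  define B :: real where "B = (2 / sqrt 3) ^ d / 64"
  \<comment> \<open>Rounding up is permitted: every natural number below the ceiling is strictly
    below \<open>B\<close>, which is all the greedy choice asks for, and the resulting count is at
    least \<open>B\<close>.\<close>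
  define m where "m = nat \<lceil>B\<rceil>"
  have "enat m \<le> h' d K"
  proof (rule h'_lower_bound)
    show "real k < (2 / sqrt 3) ^ d / 64" if "k < m" for k
      using that unfolding m_def B_def[symmetric] by linarith
  qed (use d in simp)
  then have "ereal_of_enat (enat m) \<le> ereal_of_enat (h' d K)" by (simp only: ereal_of_enat_le_iff)
  moreover have "1 / (4 * (real d)^2) * (2 / sqrt 3) ^ d \<le> B"
  proof -
    have "4 ^ 2 \<le> (real d)^2" using d by (intro power_mono) auto
    then have "1 / (4 * (real d)^2) \<le> 1 / 64" by (intro frac_le) auto
    then have "1 / (4 * (real d)^2) * (2 / sqrt 3) ^ d \<le> 1 / 64 * (2 / sqrt 3) ^ d"
      by (rule mult_right_mono) simp
    then show ?thesis by (simp add: B_def)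
  qed
  moreover have "B \<le> real m" unfolding m_def by linarith
  ultimately show "ereal (1 / (4 * (real d)^2) * (2 / sqrt 3) ^ d) \<le> ereal_of_enat (h' d K)"
    by (simp add: ereal_of_enat_simps) (metis (no_types, lifting) ereal_less_eq(3) order_trans)
qed

end
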